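(* Let $(X,\mathcal B,\mu)$ be a separable probability space. Let $T_1,\dots,T_k$ be transformations different from the identity which belong to a totally weak mixing finitely generated free abelian group $G$ acting on $(X,\mathcal B,\mu)$ by measure preserving transformations, and let $\hat T_1,\dots,\hat T_k$ be invertible $\mu$-preserving transformations of $X$ which commute with each other and with $T_1,\dots,T_k$. Let $P_{ij}(n)$, $i=1,\dots,\ell$, $j=1,\dots,k$, be polynomials taking on integer values on integers and suppose that the expressions $$\varphi_i(n)=T_1^{P_{i1}(n)}\cdots T_k^{P_{ik}(n)},\quad i=1,\dots,\ell,$$ and the expressions $$\varphi_i(n)\varphi_j^{-1}(n)=T_1^{P_{i1}(n)-P_{j1}(n)}T_2^{P_{i2}(n)-P_{j2}(n)}\cdots T_k^{P_{ik}(n)-P_{jk}(n)},\quad i,j=1,\dots,\ell,\ i\ne j,$$ depend nontrivially on $n$ (i.e. they are nonconstant maps from $\mathbb Z$ to $G$). Let $Q_{ij}(N)$, $i=1,\dots,\ell$, $j=1,\dots,k$, be arbitrary functions of $N$ taking on integer values on integers. Then, for any bounded measurable functions $f_i$, $i=1,\dots,\ell$, on $X$, $$\lim_{N\to\infty}\frac 1N\sum_{n=1}^{N}\prod_{i=1}^\ell T_1^{P_{i1}(n)}\cdots T_k^{P_{ik}(n)}\hat T_1^{Q_{i1}(N)}\cdots\hat T_k^{Q_{ik}(N)}f_i=\prod_{i=1}^\ell\int f_i\,d\mu\quad\text{in } L^2(X,\mu).$$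
   Context: For a transformation $T$ and a function $f$ on $X$, $Tf$ denotes $Tf(x)=f(Tx)$. A measure preserving transformation $T$ is weakly mixing if $T\times T$ is ergodic with respect to $\mu\times\mu$. The group $G$ is totally weak mixing if all its elements other than the identity are weakly mixing transformations. *)

theory Defs
  imports
    "HOL-Probability.Probability"
    "HOL-Algebra.Free_Abelian_Groups"
    "HOL-Algebra.Group_Action"
begin

text \<open>Separability of the metric \<open>d(A, B) = \<mu>(A \<triangle> B)\<close> on measurable sets. This holds in
  particular if the sigma-algebra is countably generated up to null sets.\<close>

definition separable_measure :: "'a measure \<Rightarrow> bool" where
  "separable_measure M \<longleftrightarrow>
     (\<exists>C. countable C \<and> C \<subseteq> sets M \<and>
        (\<forall>A\<in>sets M. \<forall>e>0. \<exists>B\<in>C. measure M ((A - B) \<union> (B - A)) < e))"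

definition measure_preserving_map :: "'a measure \<Rightarrow> ('a \<Rightarrow> 'a) \<Rightarrow> bool" where
  "measure_preserving_map M T \<longleftrightarrow> T \<in> M \<rightarrow>\<^sub>M M \<and> distr M M T = M"

text \<open>Following \<^const>\<open>Bij\<close>, an invertible transformation is represented by a function with the
  fixed junk value \<open>undefined\<close> outside \<^term>\<open>space M\<close>, so that transformations of
  \<^term>\<open>space M\<close> form the group \<^term>\<open>BijGroup (space M)\<close>.\<close>

definition invertible_measure_preserving :: "'a measure \<Rightarrow> ('a \<Rightarrow> 'a) \<Rightarrow> bool" where
  "invertible_measure_preserving M T \<longleftrightarrow>
     T \<in> carrier (BijGroup (space M)) \<and> measure_preserving_map M T \<and>
     measure_preserving_map M (inv\<^bsub>BijGroup (space M)\<^esub> T)"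

definition ergodic :: "'a measure \<Rightarrow> ('a \<Rightarrow> 'a) \<Rightarrow> bool" where
  "ergodic M T \<longleftrightarrow> measure_preserving_map M T \<and>
     (\<forall>A\<in>sets M. T -` A \<inter> space M = A \<longrightarrow> emeasure M A = 0 \<or> emeasure M (space M - A) = 0)"

definition weakly_mixing :: "'a measure \<Rightarrow> ('a \<Rightarrow> 'a) \<Rightarrow> bool" where
  "weakly_mixing M T \<longleftrightarrow> measure_preserving_map M T \<and> ergodic (M \<Otimes>\<^sub>M M) (map_prod T T)"

definition measure_preserving_action ::
    "('g, 'm) monoid_scheme \<Rightarrow> 'a measure \<Rightarrow> ('g \<Rightarrow> 'a \<Rightarrow> 'a) \<Rightarrow> bool" where
  "measure_preserving_action G M act \<longleftrightarrow>
     group_action G (space M) act \<and> (\<forall>g\<in>carrier G. measure_preserving_map M (act g))"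

definition totally_weak_mixing ::
    "('g, 'm) monoid_scheme \<Rightarrow> 'a measure \<Rightarrow> ('g \<Rightarrow> 'a \<Rightarrow> 'a) \<Rightarrow> bool" where
  "totally_weak_mixing G M act \<longleftrightarrow>
     (\<forall>g\<in>carrier G. g \<noteq> \<one>\<^bsub>G\<^esub> \<longrightarrow> weakly_mixing M (act g))"

definition fg_free_abelian :: "('g, 'm) monoid_scheme \<Rightarrow> bool" where
  "fg_free_abelian G \<longleftrightarrow> (\<exists>S :: nat set. finite S \<and> G \<cong> free_Abelian_group S)"

text \<open>\<open>x\<^sub>1\<^bsup>a 1\<^esup> \<cdots> x\<^sub>k\<^bsup>a k\<^esup>\<close>, multiplied in this order; unlike
  \<^const>\<open>finprod\<close>, it is also usable in the noncommutative group of all bijections.\<close>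

definition power_word ::
    "('g, 'm) monoid_scheme \<Rightarrow> nat \<Rightarrow> (nat \<Rightarrow> 'g) \<Rightarrow> (nat \<Rightarrow> int) \<Rightarrow> 'g" where
  "power_word G k x a =
     foldr (\<lambda>j y. (x j [^]\<^bsub>G\<^esub> a j) \<otimes>\<^bsub>G\<^esub> y) [1..<Suc k] \<one>\<^bsub>G\<^esub>"

definition integer_valued :: "real poly \<Rightarrow> bool" where
  "integer_valued p \<longleftrightarrow> (\<forall>n::int. poly p (of_int n) \<in> \<int>)"

text \<open>The floor only changes the type: it is applied to integer-valued polynomials.\<close>

definition poly_word ::
    "('g, 'm) monoid_scheme \<Rightarrow> nat \<Rightarrow> (nat \<Rightarrow> 'g) \<Rightarrow> (nat \<Rightarrow> real poly) \<Rightarrow> int \<Rightarrow> 'g" where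
  "poly_word G k T p n = power_word G k T (\<lambda>j. \<lfloor>poly (p j) (of_int n)\<rfloor>)"

definition square_integrable :: "'a measure \<Rightarrow> ('a \<Rightarrow> complex) \<Rightarrow> bool" where
  "square_integrable M f \<longleftrightarrow>
     f \<in> borel_measurable M \<and> integrable M (\<lambda>x. (cmod (f x))\<^sup>2)"

definition tendsto_L2 :: "'a measure \<Rightarrow> (nat \<Rightarrow> 'a \<Rightarrow> complex) \<Rightarrow> ('a \<Rightarrow> complex) \<Rightarrow> bool" where
  "tendsto_L2 M F g \<longleftrightarrow>
     (\<forall>N. square_integrable M (F N)) \<and> square_integrable M g \<and>
     (\<lambda>N. sqrt (\<integral>x. (cmod (F N x - g x))\<^sup>2 \<partial>M)) \<longlonglongrightarrow> 0"

end

theory Submission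
  imports Defs
begin

text \<open>
  Write \<open>\<phi>\<^sub>i(n)\<close> for the \<open>i\<close>th polynomial word and \<open>S\<^sub>i\<close> for the word in the maps \<open>hatT j\<close> belonging to
  a given \<open>N\<close>. The proof is Bergelson's PET induction: van der Corput's inequality replaces the
  family of polynomials by a simpler family of differences, until nothing is left.

  \<^emph>\<open>Reduction to mean zero.\<close> Replacing the functions \<open>f\<^sub>i\<close> one at a time by their means, it
  suffices that the averages tend to \<open>0\<close> in \<open>L\<^sup>2\<close> when some \<open>f\<^sub>i\<close> has integral \<open>0\<close>
  (lemma \<open>averages_converge_if_mean_zero_vanish\<close>).

  \<^emph>\<open>Differencing.\<close> Let \<open>u(n) = \<Prod>\<^sub>i f\<^sub>i(S\<^sub>i \<phi>\<^sub>i(n) x)\<close>. By van der Corput the averages of \<open>u\<close> are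
  small as soon as for some finite set of shifts \<open>h\<close> the correlations of \<open>u(n + h)\<close> and \<open>u(n + h')\<close>,
  averaged over \<open>n\<close>, are small on average over the pairs \<open>(h, h')\<close>. Pick one member \<open>\<phi>\<^sub>q\<close>. Since
  \<open>\<phi>\<^sub>q(n + h)\<close> preserves the measure, it can be divided out of the correlation, which turns it into
  the integral of a fixed function against an average of the same kind along the family
  \<open>\<phi>\<^sub>i(n + h) \<phi>\<^sub>q(n + h)\<^sup>-\<^sup>1\<close>, \<open>\<phi>\<^sub>i(n + h') \<phi>\<^sub>q(n + h)\<^sup>-\<^sup>1\<close>. If \<open>\<phi>\<^sub>i\<close> is affine with slope \<open>g\<close>, its two
  translates differ by the constant \<open>(h' - h) g\<close>, and their factors are merged into the single
  function \<open>f\<^sub>i \<cdot> cnj (f\<^sub>i \<circ> (h' - h) g)\<close>. The maps \<open>S\<^sub>i\<close> commute with the action and are only carried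
  along, so their dependence on \<open>N\<close> costs nothing.

  \<^emph>\<open>Smallness of the correlations.\<close> By induction the correlation tends to a product of
  integrals (lemma \<open>correlations_converge\<close>). If the mean zero function belongs to a member that is
  not affine, one of these integrals vanishes. If it belongs to an affine one, the correlation is
  bounded by \<open>\<bar>\<integral> f\<^sub>i \<cdot> cnj (f\<^sub>i \<circ> (h' - h) g)\<bar>\<close>, and weak mixing of \<open>g\<close> makes this small on average
  (lemma \<open>weakly_mixing_mean_correlation\<close>, which comes from the ergodic theorem on the product
  space). The case of a single affine \<open>\<phi>\<^sub>1\<close> is thus not special: differencing it gives the empty
  family, which is the base of the induction.

  \<^emph>\<open>Termination.\<close> A family is measured by a finite cover of its members by balls, where
  the ball of radius \<open>d\<close> about \<open>r\<close> consists of the maps \<open>p\<close> such that \<open>p - r\<close> has degree at most \<open>d\<close>.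
  Choosing \<open>\<phi>\<^sub>q\<close> in a ball of least radius \<open>d\<close>, differencing translates all other balls and breaks
  this one up into balls of radius \<open>d - 1\<close>, so the multiset of radii decreases
  (lemma \<open>averages_converge_if_covered\<close>).
\<close>


section \<open>Maps of bounded degree from the integers to an abelian group\<close>

text \<open>Degree is measured by differences: constant maps have degree \<open>0\<close>, and the degree of \<open>p\<close>
  exceeds that of its differences by one. This makes sense without coordinates in the target and
  is stable under exactly the operations that differencing a family uses.\<close>

fun poly_deg_le :: "nat \<Rightarrow> (int \<Rightarrow> 'v::ab_group_add) \<Rightarrow> bool" where
  "poly_deg_le 0 p \<longleftrightarrow> (\<forall>n. p n = p 0)"
| "poly_deg_le (Suc d) p \<longleftrightarrow> (\<forall>h. poly_deg_le d (\<lambda>n. p (n + h) - p n))"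

lemma poly_deg_le_const: "poly_deg_le d (\<lambda>n. c)"
proof (induction d arbitrary: c)
  case (Suc d)
  show ?case using Suc[of 0] by simp
qed simp

lemma poly_deg_le_shift: "poly_deg_le d p \<Longrightarrow> poly_deg_le d (\<lambda>n. p (n + a))"
proof (induction d arbitrary: p)
  case 0
  then show ?case by (metis poly_deg_le.simps(1))
next
  case (Suc d)
  show ?case unfolding poly_deg_le.simps
  proof
    fix h
    have "poly_deg_le d (\<lambda>n. p (n + h) - p n)" using Suc.prems by simp
    from Suc.IH[OF this] show "poly_deg_le d (\<lambda>n. p (n + h + a) - p (n + a))"
      by (simp add: ac_simps)
  qed
qed

lemma poly_deg_le_add:
  "poly_deg_le d p \<Longrightarrow> poly_deg_le d q \<Longrightarrow> poly_deg_le d (\<lambda>n. p n + q n)"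
proof (induction d arbitrary: p q)
  case 0
  then show ?case unfolding poly_deg_le.simps by metis
next
  case (Suc d)
  show ?case unfolding poly_deg_le.simps
  proof
    fix h
    have "poly_deg_le d (\<lambda>n. (p (n + h) - p n) + (q (n + h) - q n))"
      using Suc by simp
    then show "poly_deg_le d (\<lambda>n. p (n + h) + q (n + h) - (p n + q n))"
      by (simp only: add_diff_add)
  qed
qed

lemma poly_deg_le_uminus: "poly_deg_le d p \<Longrightarrow> poly_deg_le d (\<lambda>n. - p n)"
proof (induction d arbitrary: p)
  case 0
  then show ?case by (metis poly_deg_le.simps(1))
next
  case (Suc d)
  show ?case unfolding poly_deg_le.simps
  proof
    fix h
    have "poly_deg_le d (\<lambda>n. - (p (n + h) - p n))"
      using Suc by (metis poly_deg_le.simps(2))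
    then show "poly_deg_le d (\<lambda>n. - p (n + h) - - p n)"
      by (simp add: algebra_simps)
  qed
qed

lemma poly_deg_le_diff:
  "poly_deg_le d p \<Longrightarrow> poly_deg_le d q \<Longrightarrow> poly_deg_le d (\<lambda>n. p n - q n)"
  using poly_deg_le_add[of d p "\<lambda>n. - q n"] poly_deg_le_uminus[of d q] by simp

lemma poly_deg_le_sum:
  "(\<And>j. j \<in> J \<Longrightarrow> poly_deg_le d (p j)) \<Longrightarrow> poly_deg_le d (\<lambda>n. \<Sum>j\<in>J. p j n)"
  by (induction J rule: infinite_finite_induct)
     (auto simp: poly_deg_le_const intro: poly_deg_le_add)

lemma poly_deg_le_Suc: "poly_deg_le d p \<Longrightarrow> poly_deg_le (Suc d) p"
proof (induction d arbitrary: p)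
  case 0
  then have "p = (\<lambda>n. p 0)" by auto
  then show ?case using poly_deg_le_const by metis
next
  case (Suc d)
  then show ?case by (metis poly_deg_le.simps(2))
qed

lemma poly_deg_le_mono: "poly_deg_le d p \<Longrightarrow> d \<le> e \<Longrightarrow> poly_deg_le e p"
proof (induction e)
  case (Suc e)
  then show ?case using poly_deg_le_Suc by (cases "d = Suc e") (auto simp del: poly_deg_le.simps)
qed simp

lemma poly_deg_le_Suc_diff_shifts:
  assumes "poly_deg_le (Suc d) p"
  shows "poly_deg_le d (\<lambda>n. p (n + a) - p (n + b))"
proof -
  have "poly_deg_le d (\<lambda>n. p (n + (a - b)) - p n)" using assms by simp
  from poly_deg_le_shift[OF this, of b] show ?thesis by (simp add: ac_simps)
qed

lemma poly_deg_le_shift_iff: "poly_deg_le d (\<lambda>n. p (n + a)) \<longleftrightarrow> poly_deg_le d p"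
  using poly_deg_le_shift[of d p a] poly_deg_le_shift[of d "\<lambda>n. p (n + a)" "- a"] by auto

lemma poly_deg_le_minus_iff: "poly_deg_le d (\<lambda>n. p n - q n) \<longleftrightarrow> poly_deg_le d (\<lambda>n. q n - p n)"
  using poly_deg_le_uminus[of d "\<lambda>n. p n - q n"] poly_deg_le_uminus[of d "\<lambda>n. q n - p n"] by auto

text \<open>The differences of \<open>p\<close> are constant, so \<open>h \<mapsto> p (n + h) - p n\<close> is additive and does not depend on
  \<open>n\<close>.\<close>

lemma poly_deg_le_1_affine:
  fixes p :: "int \<Rightarrow> 'b \<Rightarrow>\<^sub>0 int"
  assumes "poly_deg_le 1 p"
  shows "p (n + h) = p n + frag_cmul h (p 1 - p 0)"
proof -
  have const: "p (n + h) - p n = p h - p 0" for n h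
    using assms unfolding One_nat_def poly_deg_le.simps by (metis add_0)
  have step: "p (n + 1) = p n + (p 1 - p 0)" for n
    using const[of n 1] by (metis add.commute diff_add_cancel)
  have step': "p (n - 1) = p n - (p 1 - p 0)" for n
    using step[of "n - 1"] by simp
  show ?thesis
  proof (induction h rule: int_induct[where k = 0])
    case (step1 i)
    have "p (n + (i + 1)) = p (n + i) + (p 1 - p 0)" using step[of "n + i"] by (simp add: add.assoc)
    then show ?case using step1 by (simp add: frag_cmul_distrib add.assoc)
  next
    case (step2 i)
    have "p (n + (i - 1)) = p (n + i) - (p 1 - p 0)" using step'[of "n + i"] by (simp add: add_diff_eq)
    then show ?case using step2 by (simp add: frag_cmul_diff_distrib add.assoc add_diff_eq)
  qed simp
qed

text \<open>The differences of a periodic map are periodic of smaller degree, hence constant by induction.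
  So the map is affine, and periodicity forces \<open>k\<close> times its slope to vanish; a free abelian group
  has no torsion.\<close>

lemma periodic_poly_const:
  fixes p :: "int \<Rightarrow> 'b \<Rightarrow>\<^sub>0 int"
  assumes "poly_deg_le d p" and "k \<noteq> 0" and "\<And>n. p (n + k) = p n"
  shows "poly_deg_le 0 p"
  using assms(1,3)
proof (induction d arbitrary: p)
  case (Suc d)
  have "poly_deg_le 1 p"
    unfolding One_nat_def poly_deg_le.simps(2)
  proof
    fix h
    show "poly_deg_le 0 (\<lambda>n. p (n + h) - p n)"
    proof (rule Suc.IH)
      show "poly_deg_le d (\<lambda>n. p (n + h) - p n)" using Suc.prems by simp
      show "p (n + k + h) - p (n + k) = p (n + h) - p n" for n
        using Suc.prems(2)[of "n + h"] Suc.prems(2)[of n] by (simp add: ac_simps)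
    qed
  qed
  note aff = poly_deg_le_1_affine[OF this]
  have "frag_cmul k (p 1 - p 0) = 0" using aff[of 0 k] Suc.prems(2)[of 0] by simp
  then have "p 1 - p 0 = 0" using assms(2) by simp
  then show ?case using aff[of 0] by simp
qed

text \<open>If two translates of \<open>p\<close> differ from \<open>q\<close> by constants, they differ from each other by a constant, so all
  differences of \<open>p\<close> are periodic and hence constant. Consequently, only finitely many pairs of
  shifts make two translates in a differenced family coincide up to a constant.\<close>

lemma nonaffine_shift_unique:
  fixes p q :: "int \<Rightarrow> 'b \<Rightarrow>\<^sub>0 int"
  assumes "poly_deg_le d p" and "\<not> poly_deg_le 1 p"
    and "poly_deg_le 0 (\<lambda>n. p (n + s) - q n)" and "poly_deg_le 0 (\<lambda>n. p (n + t) - q n)"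
  shows "s = t"
proof (rule ccontr)
  assume "s \<noteq> t"
  have "poly_deg_le 0 (\<lambda>n. (p (n + s) - q n) - (p (n + t) - q n))"
    by (rule poly_deg_le_diff[OF assms(3,4)])
  then have "poly_deg_le 0 (\<lambda>n. p (n + s) - p (n + t))" by simp
  from poly_deg_le_shift[OF this, of "- t"]
  have k: "p (n + (s - t)) - p n = p (s - t) - p 0" for n by (simp add: algebra_simps)
  have k': "p (n + (s - t)) = p n + (p (s - t) - p 0)" for n
    using k[of n] by (metis add.commute diff_add_cancel)
  have "poly_deg_le 1 p"
    unfolding One_nat_def poly_deg_le.simps(2)
  proof
    fix h
    show "poly_deg_le 0 (\<lambda>n. p (n + h) - p n)"
    proof (rule periodic_poly_const)
      show "poly_deg_le d (\<lambda>n. p (n + h) - p n)"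
        by (rule poly_deg_le_diff[OF poly_deg_le_shift[OF assms(1)] assms(1)])
      show "s - t \<noteq> 0" using \<open>s \<noteq> t\<close> by simp
      show "p (n + (s - t) + h) - p (n + (s - t)) = p (n + h) - p n" for n
        using k'[of n] k'[of "n + h"] by (simp add: ac_simps)
    qed
  qed
  then show False using assms(2) by simp
qed

lemma poly_deg_le_of_int_iff:
  "poly_deg_le d (\<lambda>n. of_int (a n) :: 'c::ring_char_0) \<longleftrightarrow> poly_deg_le d a"
proof (induction d arbitrary: a)
  case (Suc d)
  show ?case using Suc[of "\<lambda>n. a (n + h) - a n" for h] by simp
qed simp

text \<open>Induction on the degree: a translate of \<open>P\<close> has the same leading coefficient as \<open>P\<close>.\<close>

lemma poly_deg_le_poly:
  fixes P :: "real poly"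
  shows "degree P \<le> d \<Longrightarrow> poly_deg_le d (\<lambda>n. poly P (of_int n))"
proof (induction d arbitrary: P)
  case 0
  then obtain c where "P = [:c:]" by (metis degree_eq_zeroE le_zero_eq)
  then show ?case by simp
next
  case (Suc d)
  show ?case unfolding poly_deg_le.simps
  proof
    fix h :: int
    define R where "R = P \<circ>\<^sub>p [:of_int h, 1:]"
    have deg: "degree R = degree P" unfolding R_def by (simp add: degree_pcompose)
    have lead: "lead_coeff R = lead_coeff P" unfolding R_def by (subst lead_coeff_comp) auto
    have "degree (R - P) \<le> d"
    proof (cases "degree P = 0")
      case True
      then show ?thesis using deg by (metis degree_diff_le le0)
    next
      case False
      have "degree (R - P) < degree P"
        using False deg lead
        by (metis coeff_diff degree_diff_le degree_0 diff_self gr0I le_neq_implies_less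
            leading_coeff_0_iff order_refl)
      then show ?thesis using Suc.prems by simp
    qed
    from Suc.IH[OF this] show "poly_deg_le d (\<lambda>n. poly P (of_int (n + h)) - poly P (of_int n))"
      by (simp add: R_def poly_pcompose ac_simps)
  qed
qed

lemma poly_deg_le_frag_cmul:
  "poly_deg_le d a \<Longrightarrow> poly_deg_le d (\<lambda>n. frag_cmul (a n) v)"
proof (induction d arbitrary: a)
  case 0
  then show ?case by (metis poly_deg_le.simps(1))
next
  case (Suc d)
  then show ?case by (simp flip: frag_cmul_diff_distrib)
qed

declare poly_deg_le.simps [simp del]

section \<open>The ergodic theorem and correlations of weakly mixing maps\<close>

definition bdd_meas :: "'a measure \<Rightarrow> real \<Rightarrow> ('a \<Rightarrow> complex) \<Rightarrow> bool" where
  "bdd_meas M B f \<longleftrightarrow> f \<in> borel_measurable M \<and> (\<forall>x\<in>space M. cmod (f x) \<le> B)"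

lemma borel_measurable_cnj [measurable (raw)]:
  "f \<in> borel_measurable M \<Longrightarrow> (\<lambda>x. cnj (f x)) \<in> borel_measurable M"
  by (rule borel_measurable_continuous_on[OF continuous_on_cnj[OF continuous_on_id]])

lemma measure_preserving_map_funpow_measurable:
  assumes "measure_preserving_map M T"
  shows "(T ^^ n) \<in> M \<rightarrow>\<^sub>M M"
  using assms unfolding measure_preserving_map_def
  by (induction n) (auto intro: measurable_comp simp: funpow_Suc_right simp del: funpow.simps(2))

lemma measure_preserving_integral:
  fixes g :: "'a \<Rightarrow> 'b::{banach, second_countable_topology}"
  assumes "measure_preserving_map M T" and "g \<in> borel_measurable M"
  shows "(\<integral>x. g (T x) \<partial>M) = (\<integral>x. g x \<partial>M)"
  using assms integral_distr[of T M M g] unfolding measure_preserving_map_def by simp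

context prob_space begin

lemma integrable_bdd:
  fixes f :: "'a \<Rightarrow> 'b::{banach, second_countable_topology}"
  assumes "f \<in> borel_measurable M" and "\<And>x. x \<in> space M \<Longrightarrow> norm (f x) \<le> B"
  shows "integrable M f"
  by (rule integrable_const_bound[where B = B]) (use assms in auto)

text \<open>The largest of the sums \<open>\<Sum>n<k. f (T\<^sup>n x)\<close> with \<open>k \<le> N\<close>. The recursion, rather than the maximum
  itself, is what the ergodic theorem needs.\<close>

primrec max_birkhoff_sum :: "('a \<Rightarrow> 'a) \<Rightarrow> ('a \<Rightarrow> real) \<Rightarrow> nat \<Rightarrow> 'a \<Rightarrow> real" where
  "max_birkhoff_sum T f 0 x = 0"
| "max_birkhoff_sum T f (Suc N) x = max 0 (f x + max_birkhoff_sum T f N (T x))"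

lemma birkhoff_sum_le_max: "(\<Sum>n<N. f ((T ^^ n) x)) \<le> max_birkhoff_sum T f N x"
proof (induction N arbitrary: x)
  case (Suc N)
  have "(\<Sum>n<Suc N. f ((T ^^ n) x)) = f x + (\<Sum>n<N. f ((T ^^ n) (T x)))"
    by (simp add: sum.lessThan_Suc_shift funpow_swap1 del: sum.lessThan_Suc)
  then show ?case using Suc[of "T x"] by simp
qed simp

lemma max_birkhoff_sum_nonneg: "0 \<le> max_birkhoff_sum T f N x"
  by (cases N) auto

lemma max_birkhoff_sum_mono: "max_birkhoff_sum T f N x \<le> max_birkhoff_sum T f (Suc N) x"
proof (induction N arbitrary: x)
  case (Suc N)
  show ?case using Suc[of "T x"] by (subst (1 2) max_birkhoff_sum.simps) linarith
qed simp

lemma max_birkhoff_sum_measurable: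
  assumes "T \<in> M \<rightarrow>\<^sub>M M" and "f \<in> borel_measurable M"
  shows "max_birkhoff_sum T f N \<in> borel_measurable M"
proof (induction N)
  case (Suc N)
  have "(\<lambda>x. max_birkhoff_sum T f N (T x)) \<in> borel_measurable M"
    by (rule measurable_compose[OF assms(1) Suc])
  then have "(\<lambda>x. max 0 (f x + max_birkhoff_sum T f N (T x))) \<in> borel_measurable M"
    using assms(2) by measurable
  then show ?case by simp
qed (simp add: max_birkhoff_sum_def)

lemma max_birkhoff_sum_le:
  assumes "T \<in> M \<rightarrow>\<^sub>M M" and "\<And>x. x \<in> space M \<Longrightarrow> \<bar>f x\<bar> \<le> B" and "x \<in> space M"
  shows "max_birkhoff_sum T f N x \<le> real N * B"
  using assms(3)
proof (induction N arbitrary: x)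
  case (Suc N)
  have Tx: "T x \<in> space M" by (rule measurable_space[OF assms(1) Suc.prems])
  have "max_birkhoff_sum T f N (T x) \<le> real N * B" by (rule Suc.IH[OF Tx])
  moreover have "\<bar>f x\<bar> \<le> B" by (rule assms(2)[OF Suc.prems])
  moreover have "0 \<le> real N * B" using calculation(2) by simp
  ultimately show ?case by (simp add: algebra_simps)
qed simp

text \<open>Let \<open>m N\<close> be the maximal sums. The set where \<open>m N \<longrightarrow> \<infinity>\<close> is invariant, so by
  ergodicity it is null, as required, or has full measure. In the latter case \<open>m (N + 1) - m N \<circ> T\<close> tends to \<open>f\<close>, because the maximum with \<open>0\<close> in the recursion is
  eventually attained by the other term. These functions are bounded, and their integrals are
  nonnegative since \<open>T\<close> preserves the measure and \<open>m\<close> increases; so \<open>\<integral> f \<ge> 0\<close>, a contradiction.\<close>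

lemma birkhoff_sums_bdd_above:
  fixes f :: "'a \<Rightarrow> real"
  assumes "ergodic M T" and f: "f \<in> borel_measurable M"
    and B: "\<And>x. x \<in> space M \<Longrightarrow> \<bar>f x\<bar> \<le> B" and neg: "(\<integral>x. f x \<partial>M) < 0"
  shows "AE x in M. \<exists>C. \<forall>N. (\<Sum>n<N. f ((T ^^ n) x)) \<le> C"
proof -
  let ?m = "max_birkhoff_sum T f"
  have mp: "measure_preserving_map M T" using assms(1) by (simp add: ergodic_def)
  then have T: "T \<in> M \<rightarrow>\<^sub>M M" by (simp add: measure_preserving_map_def)
  note [measurable] = T f max_birkhoff_sum_measurable[OF T f]
  have incr: "incseq (\<lambda>N. ?m N x)" for x by (rule incseq_SucI) (rule max_birkhoff_sum_mono)
  define A where "A = {x \<in> space M. \<forall>C::nat. \<exists>N. ?m N x > real C}"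
  have A_sets: "A \<in> sets M" unfolding A_def by measurable
  have inv: "T x \<in> A \<longleftrightarrow> x \<in> A" if x: "x \<in> space M" for x
  proof -
    have Tx: "T x \<in> space M" by (rule measurable_space[OF T x])
    have fx: "\<bar>f x\<bar> \<le> B" by (rule B[OF x])
    obtain b :: nat where b: "B \<le> real b" using real_arch_simple by blast
    show ?thesis
    proof
      assume "T x \<in> A"
      have "\<exists>N. ?m N x > real C" for C
      proof -
        obtain N where "?m N (T x) > real (C + b)" using \<open>T x \<in> A\<close> unfolding A_def by blast
        then have "?m (Suc N) x > real C" using fx b by simp
        then show ?thesis by blast
      qed
      then show "x \<in> A" using x unfolding A_def by blast
    next
      assume "x \<in> A"
      have "\<exists>N. ?m N (T x) > real C" for C
      proof -
        obtain N where "?m N x > real (C + b)" using \<open>x \<in> A\<close> unfolding A_def by blast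
        then have "?m (Suc N) x > real (C + b)" using max_birkhoff_sum_mono[of T f N x] by linarith
        then have "?m N (T x) > real C" using fx b by (simp add: max_def split: if_splits)
        then show ?thesis by blast
      qed
      then show "T x \<in> A" using Tx unfolding A_def by blast
    qed
  qed
  have "T -` A \<inter> space M = A" using inv unfolding A_def by auto
  then consider "emeasure M A = 0" | "emeasure M (space M - A) = 0"
    using assms(1) A_sets unfolding ergodic_def by blast
  then show ?thesis
  proof cases
    case 1
    then have "AE x in M. x \<notin> A" using A_sets by (intro AE_not_in) auto
    moreover have "AE x in M. x \<in> space M" by simp
    ultimately show ?thesis
    proof eventually_elim
      case (elim x)
      then obtain C :: nat where "\<And>N. ?m N x \<le> real C" unfolding A_def by (auto simp: not_less)
      then show ?case using birkhoff_sum_le_max order_trans by blast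
    qed
  next
    case 2
    have full: "AE x in M. x \<in> A"
      using 2 A_sets by (intro AE_I[where N = "space M - A"]) auto
    let ?D = "\<lambda>N x. ?m (Suc N) x - ?m N (T x)"
    have lim: "(\<lambda>N. \<integral>x. ?D N x \<partial>M) \<longlonglongrightarrow> (\<integral>x. f x \<partial>M)"
    proof (rule integral_dominated_convergence[where w = "\<lambda>_. B"])
      show "AE x in M. (\<lambda>N. ?D N x) \<longlonglongrightarrow> f x"
        using full
      proof eventually_elim
        case (elim x)
        then have x: "x \<in> space M" and TA: "T x \<in> A" using inv by (auto simp: A_def)
        obtain b :: nat where b: "B \<le> real b" using real_arch_simple by blast
        obtain N0 where N0: "?m N0 (T x) > real b" using TA unfolding A_def by blast
        have "?D N x = f x" if "N \<ge> N0" for N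
        proof -
          have "?m N0 (T x) \<le> ?m N (T x)" using incr that by (auto simp: incseq_def)
          then show ?thesis using N0 b B[OF x] by simp
        qed
        then show ?case by (intro tendsto_eventually eventually_sequentiallyI)
      qed
      show "AE x in M. norm (?D N x) \<le> B" for N
      proof (rule AE_I2)
        fix x assume "x \<in> space M"
        from B[OF this] show "norm (?D N x) \<le> B"
          using max_birkhoff_sum_nonneg[of T f N "T x"] by (auto simp: max_def)
      qed
      show "?D N \<in> borel_measurable M" for N
        by (intro borel_measurable_diff max_birkhoff_sum_measurable[OF T f]
              measurable_compose[OF T max_birkhoff_sum_measurable[OF T f]])
    qed (use f in simp_all)
    have int: "integrable M (?m N)" for N
      by (rule integrable_bdd[where B = "real N * B"])
         (use max_birkhoff_sum_nonneg max_birkhoff_sum_le[OF T B] in auto)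
    have intT: "integrable M (\<lambda>x. ?m N (T x))" for N
      by (rule integrable_bdd[where B = "real N * B"])
         (use max_birkhoff_sum_nonneg max_birkhoff_sum_le[OF T B] measurable_space[OF T] in auto)
    have "0 \<le> (\<integral>x. ?D N x \<partial>M)" for N
    proof -
      have "(\<integral>x. ?D N x \<partial>M) = (\<integral>x. ?m (Suc N) x \<partial>M) - (\<integral>x. ?m N (T x) \<partial>M)"
        by (rule Bochner_Integration.integral_diff[OF int intT])
      also have "(\<integral>x. ?m N (T x) \<partial>M) = (\<integral>x. ?m N x \<partial>M)"
        by (rule measure_preserving_integral[OF mp]) measurable
      also have "(\<integral>x. ?m (Suc N) x \<partial>M) - (\<integral>x. ?m N x \<partial>M) \<ge> 0"
        using integral_mono[OF int int max_birkhoff_sum_mono] by simp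
      finally show ?thesis .
    qed
    then have "0 \<le> (\<integral>x. f x \<partial>M)" by (intro LIMSEQ_le_const[OF lim]) auto
    then show ?thesis using neg by simp
  qed
qed

text \<open>The sums of \<open>f - e/2\<close>, a function of negative mean, are bounded above almost everywhere.\<close>

lemma birkhoff_avg_le:
  fixes f :: "'a \<Rightarrow> real"
  assumes "ergodic M T" and f: "f \<in> borel_measurable M"
    and B: "\<And>x. x \<in> space M \<Longrightarrow> \<bar>f x\<bar> \<le> B" and zero: "(\<integral>x. f x \<partial>M) = 0" and "e > 0"
  shows "AE x in M. \<forall>\<^sub>F N in sequentially. (\<Sum>n<N. f ((T ^^ n) x)) / N \<le> e"
proof -
  have int: "integrable M f" by (rule integrable_bdd[where B = B]) (use f B in auto)
  have "AE x in M. \<exists>C. \<forall>N. (\<Sum>n<N. (f ((T ^^ n) x) - e/2)) \<le> C"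
  proof (rule birkhoff_sums_bdd_above[OF assms(1), where B = "B + e/2"])
    show "(\<lambda>x. f x - e/2) \<in> borel_measurable M" using f by measurable
    show "\<bar>f x - e/2\<bar> \<le> B + e/2" if "x \<in> space M" for x using B[OF that] \<open>e > 0\<close> by linarith
    show "(\<integral>x. f x - e/2 \<partial>M) < 0" using int zero \<open>e > 0\<close> by (simp add: prob_space)
  qed
  then show ?thesis
  proof eventually_elim
    case (elim x)
    then obtain C where C: "\<And>N. (\<Sum>n<N. f ((T ^^ n) x)) \<le> C + N * (e/2)"
      by (auto simp: sum_subtractf algebra_simps)
    have "(\<lambda>N. C / real N + e/2) \<longlonglongrightarrow> 0 + e/2"
      by (intro tendsto_add tendsto_const tendsto_divide_0[OF tendsto_const]
            filterlim_at_top_imp_at_infinity filterlim_real_sequentially)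
    then have "\<forall>\<^sub>F N in sequentially. C / real N + e/2 < e"
      by (rule order_tendstoD(2)) (use \<open>e > 0\<close> in simp)
    then show ?case
      using eventually_gt_at_top[of 0]
    proof eventually_elim
      case (elim N)
      have "(\<Sum>n<N. f ((T ^^ n) x)) / N \<le> (C + N * (e/2)) / N"
        using C[of N] elim(2) by (intro divide_right_mono) auto
      also have "\<dots> = C / real N + e/2" using elim(2) by (simp add: add_divide_distrib)
      finally show ?case using elim(1) by simp
    qed
  qed
qed

lemma birkhoff_avg_tendsto_0:
  fixes f :: "'a \<Rightarrow> real"
  assumes "ergodic M T" and f: "f \<in> borel_measurable M"
    and B: "\<And>x. x \<in> space M \<Longrightarrow> \<bar>f x\<bar> \<le> B" and zero: "(\<integral>x. f x \<partial>M) = 0"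
  shows "AE x in M. (\<lambda>N. (\<Sum>n<N. f ((T ^^ n) x)) / N) \<longlonglongrightarrow> 0"
proof -
  have 1: "AE x in M. \<forall>k::nat. \<forall>\<^sub>F N in sequentially. (\<Sum>n<N. f ((T ^^ n) x)) / N \<le> inverse (Suc k)"
    unfolding AE_all_countable using birkhoff_avg_le[OF assms(1) f B zero] by simp
  have 2: "AE x in M. \<forall>k::nat. \<forall>\<^sub>F N in sequentially. (\<Sum>n<N. - f ((T ^^ n) x)) / N \<le> inverse (Suc k)"
    unfolding AE_all_countable
    using birkhoff_avg_le[OF assms(1), where f = "\<lambda>x. - f x" and B = B] f B zero by simp
  from 1 2 show ?thesis
  proof eventually_elim
    case (elim x)
    show ?case
    proof (rule tendstoI)
      fix e :: real assume "e > 0"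
      then obtain k where k: "inverse (real (Suc k)) < e" using reals_Archimedean by blast
      from elim(1)[rule_format, of k] elim(2)[rule_format, of k]
      show "\<forall>\<^sub>F N in sequentially. dist ((\<Sum>n<N. f ((T ^^ n) x)) / real N) 0 < e"
        by eventually_elim (use k in \<open>auto simp: sum_negf\<close>)
    qed
  qed
qed

lemma mean_ergodic:
  assumes "ergodic M T" and F: "bdd_meas M B F" and zero: "(\<integral>x. F x \<partial>M) = 0"
  shows "(\<lambda>N. \<integral>x. (cmod ((\<Sum>n<N. F ((T ^^ n) x)) / N))\<^sup>2 \<partial>M) \<longlonglongrightarrow> 0"
proof -
  have mp: "measure_preserving_map M T" using assms(1) by (simp add: ergodic_def)
  note Tn[measurable] = measure_preserving_map_funpow_measurable[OF mp]
  have [measurable]: "T \<in> M \<rightarrow>\<^sub>M M" using mp by (simp add: measure_preserving_map_def)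
  have Fm[measurable]: "F \<in> borel_measurable M" and FB: "\<And>x. x \<in> space M \<Longrightarrow> cmod (F x) \<le> B"
    using F by (auto simp: bdd_meas_def)
  have [measurable]: "(\<lambda>x. F ((T ^^ n) x)) \<in> borel_measurable M" for n
    by (rule measurable_compose[OF Tn Fm])
  have int: "integrable M F" by (rule integrable_bdd[where B = B]) (use FB in auto)
  obtain x0 where "x0 \<in> space M" using not_empty by blast
  then have B0: "0 \<le> B" using FB[of x0] norm_ge_zero order_trans by blast
  have re: "AE x in M. (\<lambda>N. (\<Sum>n<N. Re (F ((T ^^ n) x))) / N) \<longlonglongrightarrow> 0"
  proof (rule birkhoff_avg_tendsto_0[OF assms(1)])
    show "\<bar>Re (F x)\<bar> \<le> B" if "x \<in> space M" for x using FB[OF that] abs_Re_le_cmod order_trans by blast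
    show "(\<integral>x. Re (F x) \<partial>M) = 0" using integral_Re[OF int] zero by simp
  qed measurable
  have im: "AE x in M. (\<lambda>N. (\<Sum>n<N. Im (F ((T ^^ n) x))) / N) \<longlonglongrightarrow> 0"
  proof (rule birkhoff_avg_tendsto_0[OF assms(1)])
    show "\<bar>Im (F x)\<bar> \<le> B" if "x \<in> space M" for x using FB[OF that] abs_Im_le_cmod order_trans by blast
    show "(\<integral>x. Im (F x) \<partial>M) = 0" using integral_Im[OF int] zero by simp
  qed measurable
  have "(\<lambda>N. \<integral>x. (cmod ((\<Sum>n<N. F ((T ^^ n) x)) / N))\<^sup>2 \<partial>M) \<longlonglongrightarrow> (\<integral>x. 0 \<partial>M)"
  proof (rule integral_dominated_convergence[where w = "\<lambda>_. B\<^sup>2"])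
    show "AE x in M. (\<lambda>N. (cmod ((\<Sum>n<N. F ((T ^^ n) x)) / N))\<^sup>2) \<longlonglongrightarrow> 0"
      using re im
    proof eventually_elim
      case (elim x)
      have "(\<lambda>N. ((\<Sum>n<N. Re (F ((T ^^ n) x))) / N)\<^sup>2 + ((\<Sum>n<N. Im (F ((T ^^ n) x))) / N)\<^sup>2)
          \<longlonglongrightarrow> 0\<^sup>2 + 0\<^sup>2"
        by (intro tendsto_add tendsto_power elim)
      then show ?case by (simp add: cmod_power2)
    qed
    show "AE x in M. norm ((cmod ((\<Sum>n<N. F ((T ^^ n) x)) / N))\<^sup>2) \<le> B\<^sup>2" for N
    proof (rule AE_I2)
      fix x assume x: "x \<in> space M"
      have "cmod (\<Sum>n<N. F ((T ^^ n) x)) \<le> (\<Sum>n<N. B)"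
        by (rule sum_norm_le) (use FB measurable_space[OF Tn x] in auto)
      then have "cmod ((\<Sum>n<N. F ((T ^^ n) x)) / N) \<le> B"
        using B0 by (cases "N = 0") (auto simp: norm_divide field_simps)
      then show "norm ((cmod ((\<Sum>n<N. F ((T ^^ n) x)) / N))\<^sup>2) \<le> B\<^sup>2"
        by (simp add: power_mono)
    qed
  qed simp_all
  then show ?thesis by simp
qed

text \<open>Let \<open>F(x, y) = f(x) cnj (f(y))\<close> on the product space. The squared modulus of a correlation of \<open>f\<close>
  is a correlation of \<open>F\<close>, so the average in question is the squared \<open>L\<^sup>2\<close> norm of an ergodic average of
  \<open>F\<close>, and \<open>F\<close> has mean zero.\<close>

lemma weakly_mixing_correlations:
  assumes "weakly_mixing M T" and f: "bdd_meas M B f" and zero: "(\<integral>x. f x \<partial>M) = 0"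
  shows "(\<lambda>H. (\<Sum>s<H. \<Sum>t<H. (cmod (\<integral>x. f ((T ^^ s) x) * cnj (f ((T ^^ t) x)) \<partial>M))\<^sup>2) / (real H)\<^sup>2)
    \<longlonglongrightarrow> 0"
proof -
  interpret P: pair_prob_space M M ..
  have mp: "measure_preserving_map M T" and erg: "ergodic (M \<Otimes>\<^sub>M M) (map_prod T T)"
    using assms(1) by (auto simp: weakly_mixing_def)
  note Tn = measure_preserving_map_funpow_measurable[OF mp]
  have fm[measurable]: "f \<in> borel_measurable M" and fB: "\<And>x. x \<in> space M \<Longrightarrow> cmod (f x) \<le> B"
    using f by (auto simp: bdd_meas_def)
  have [measurable]: "(\<lambda>x. f ((T ^^ n) x)) \<in> borel_measurable M" for n
    by (rule measurable_compose[OF Tn fm])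
  have fnB: "cmod (f ((T ^^ n) x)) \<le> B" if "x \<in> space M" for n x
    using fB measurable_space[OF Tn that] by blast
  obtain x0 where "x0 \<in> space M" using not_empty by blast
  then have B0: "0 \<le> B" using fB[of x0] norm_ge_zero order_trans by blast
  define F where "F = (\<lambda>z. f (fst z) * cnj (f (snd z)))"
  have pow: "(map_prod T T ^^ n) z = ((T ^^ n) (fst z), (T ^^ n) (snd z))" for n z
    by (induction n) (auto simp: map_prod_def split_beta)
  have tensor: "(\<integral>z. g (fst z) * cnj (g (snd z)) \<partial>(M \<Otimes>\<^sub>M M)) = (cmod (\<integral>x. g x \<partial>M))\<^sup>2"
    if [measurable]: "g \<in> borel_measurable M" and gC: "\<And>x. x \<in> space M \<Longrightarrow> cmod (g x) \<le> C" for g C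
  proof -
    have "integrable (M \<Otimes>\<^sub>M M) (\<lambda>z. g (fst z) * cnj (g (snd z)))"
      by (rule P.P.integrable_bdd[where B = "C * C"])
         (auto simp: norm_mult space_pair_measure intro!: mult_mono' gC)
    then have "(\<integral>z. g (fst z) * cnj (g (snd z)) \<partial>(M \<Otimes>\<^sub>M M))
        = (\<integral>x. (\<integral>y. g x * cnj (g y) \<partial>M) \<partial>M)"
      using P.integral_fst'[of "\<lambda>z. g (fst z) * cnj (g (snd z))"] by simp
    also have "\<dots> = (\<integral>x. g x * cnj (\<integral>y. g y \<partial>M) \<partial>M)"
      by (simp add: integral_cnj)
    also have "\<dots> = (\<integral>x. g x \<partial>M) * cnj (\<integral>y. g y \<partial>M)"
      by simp
    finally show ?thesis by (simp only: complex_norm_square)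
  qed
  have Fbdd: "bdd_meas (M \<Otimes>\<^sub>M M) (B * B) F"
    unfolding bdd_meas_def F_def
    by (auto simp: norm_mult space_pair_measure intro!: mult_mono' fB)
  have Fzero: "(\<integral>z. F z \<partial>(M \<Otimes>\<^sub>M M)) = 0"
    unfolding F_def using tensor[OF fm fB] zero by simp
  have lim: "(\<lambda>N. \<integral>z. (cmod ((\<Sum>n<N. F ((map_prod T T ^^ n) z)) / N))\<^sup>2 \<partial>(M \<Otimes>\<^sub>M M)) \<longlonglongrightarrow> 0"
    by (rule P.P.mean_ergodic[OF erg Fbdd Fzero])
  have "(\<integral>z. (cmod ((\<Sum>n<H. F ((map_prod T T ^^ n) z)) / H))\<^sup>2 \<partial>(M \<Otimes>\<^sub>M M))
      = (\<Sum>s<H. \<Sum>t<H. (cmod (\<integral>x. f ((T ^^ s) x) * cnj (f ((T ^^ t) x)) \<partial>M))\<^sup>2) / (real H)\<^sup>2" for H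
  proof -
    let ?g = "\<lambda>s t x. f ((T ^^ s) x) * cnj (f ((T ^^ t) x))"
    have gB: "cmod (?g s t x) \<le> B * B" if "x \<in> space M" for s t x
      using fnB[OF that] by (auto simp: norm_mult intro!: mult_mono')
    have int: "integrable (M \<Otimes>\<^sub>M M) (\<lambda>z. ?g s t (fst z) * cnj (?g s t (snd z)))" for s t
      by (rule P.P.integrable_bdd[where B = "(B * B) * (B * B)"], measurable)
         (use gB in \<open>auto simp: norm_mult space_pair_measure intro!: mult_mono' fnB\<close>)
    have eq: "complex_of_real ((cmod ((\<Sum>n<H. F ((map_prod T T ^^ n) z)) / H))\<^sup>2)
        = (\<Sum>s<H. \<Sum>t<H. ?g s t (fst z) * cnj (?g s t (snd z))) / (of_nat H)\<^sup>2" for z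
      unfolding complex_norm_square
      by (simp add: pow F_def sum_product power2_eq_square cnj_sum mult_ac)
    have "complex_of_real (\<integral>z. (cmod ((\<Sum>n<H. F ((map_prod T T ^^ n) z)) / H))\<^sup>2 \<partial>(M \<Otimes>\<^sub>M M))
        = (\<integral>z. (\<Sum>s<H. \<Sum>t<H. ?g s t (fst z) * cnj (?g s t (snd z))) / (of_nat H)\<^sup>2 \<partial>(M \<Otimes>\<^sub>M M))"
      unfolding integral_complex_of_real[symmetric] eq ..
    also have "\<dots> = (\<Sum>s<H. \<Sum>t<H. (\<integral>z. ?g s t (fst z) * cnj (?g s t (snd z)) \<partial>(M \<Otimes>\<^sub>M M))) / (of_nat H)\<^sup>2"
      using int by (simp add: Bochner_Integration.integral_sum Bochner_Integration.integrable_sum)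
    also have "\<dots> = (\<Sum>s<H. \<Sum>t<H. of_real ((cmod (\<integral>x. ?g s t x \<partial>M))\<^sup>2)) / (of_nat H)\<^sup>2"
      by (subst tensor[OF _ gB]) (auto simp: measurable_def)
    also have "\<dots> = of_real ((\<Sum>s<H. \<Sum>t<H. (cmod (\<integral>x. ?g s t x \<partial>M))\<^sup>2) / (real H)\<^sup>2)"
      by simp
    finally show ?thesis using of_real_eq_iff by blast
  qed
  then show ?thesis using lim by simp
qed

text \<open>Passing from squares to first powers is the Cauchy--Schwarz inequality over the \<open>H\<^sup>2\<close> pairs.\<close>

lemma weakly_mixing_mean_correlation:
  assumes "weakly_mixing M T" and f: "bdd_meas M B f" and zero: "(\<integral>x. f x \<partial>M) = 0"
  shows "(\<lambda>H. (\<Sum>s<H. \<Sum>t<H. cmod (\<integral>x. f ((T ^^ s) x) * cnj (f ((T ^^ t) x)) \<partial>M)) / (real H)\<^sup>2)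
    \<longlonglongrightarrow> 0"
proof (rule tendsto_sandwich[OF _ _ tendsto_const])
  let ?a = "\<lambda>s t. cmod (\<integral>x. f ((T ^^ s) x) * cnj (f ((T ^^ t) x)) \<partial>M)"
  show "\<forall>\<^sub>F H in sequentially. 0 \<le> (\<Sum>s<H. \<Sum>t<H. ?a s t) / (real H)\<^sup>2"
    by (intro always_eventually allI divide_nonneg_nonneg sum_nonneg) auto
  have "(\<Sum>s<H. \<Sum>t<H. ?a s t) / (real H)\<^sup>2 \<le> sqrt ((\<Sum>s<H. \<Sum>t<H. (?a s t)\<^sup>2) / (real H)\<^sup>2)" for H
  proof (rule real_le_rsqrt)
    have "(\<Sum>s<H. \<Sum>t<H. ?a s t)\<^sup>2 \<le> (\<Sum>s<H. \<Sum>t<H. (?a s t)\<^sup>2) * (real H)\<^sup>2"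
      using sum_squared_le_sum_of_squares[of "\<lambda>(s, t). ?a s t" "{..<H} \<times> {..<H}"]
      by (simp add: sum.cartesian_product split_def power2_eq_square)
    then show "((\<Sum>s<H. \<Sum>t<H. ?a s t) / (real H)\<^sup>2)\<^sup>2 \<le> (\<Sum>s<H. \<Sum>t<H. (?a s t)\<^sup>2) / (real H)\<^sup>2"
      by (cases "H = 0") (simp_all add: power_divide divide_simps power2_eq_square mult_ac)
  qed
  then show "\<forall>\<^sub>F H in sequentially. (\<Sum>s<H. \<Sum>t<H. ?a s t) / (real H)\<^sup>2
      \<le> sqrt ((\<Sum>s<H. \<Sum>t<H. (?a s t)\<^sup>2) / (real H)\<^sup>2)" by simp
  show "(\<lambda>H. sqrt ((\<Sum>s<H. \<Sum>t<H. (?a s t)\<^sup>2) / (real H)\<^sup>2)) \<longlonglongrightarrow> 0"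
    using tendsto_real_sqrt[OF weakly_mixing_correlations[OF assms]] by simp
qed

end

section \<open>Van der Corput's inequality\<close>

text \<open>Moving the window by one step changes only two terms.\<close>

lemma norm_shifted_sum_diff_le:
  fixes u :: "int \<Rightarrow> complex"
  assumes "\<And>n. cmod (u n) \<le> 1"
  shows "cmod ((\<Sum>n = 1..N. u (int n + a)) - (\<Sum>n = 1..N. u (int n))) \<le> 2 * \<bar>of_int a\<bar>"
proof -
  let ?S = "\<lambda>a. \<Sum>n = 1..N. u (int n + a)"
  have step: "cmod (?S (a + 1) - ?S a) \<le> 2" for a
  proof -
    have "?S (a + 1) - ?S a = u (int N + 1 + a) - u (1 + a)"
      by (induction N) (simp_all add: algebra_simps)
    also have "cmod \<dots> \<le> cmod (u (int N + 1 + a)) + cmod (u (1 + a))" by (rule norm_triangle_ineq4)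
    also have "\<dots> \<le> 2" using assms[of "int N + 1 + a"] assms[of "1 + a"] by simp
    finally show ?thesis .
  qed
  have "cmod (?S a - ?S 0) \<le> 2 * \<bar>of_int a\<bar>"
  proof (induction a rule: int_induct[where k = 0])
    case (step1 i)
    have "cmod (?S (i + 1) - ?S 0) \<le> cmod (?S (i + 1) - ?S i) + cmod (?S i - ?S 0)"
      using norm_triangle_ineq[of "?S (i + 1) - ?S i" "?S i - ?S 0"] by simp
    then show ?case using step[of i] step1 by simp
  next
    case (step2 i)
    have "cmod (?S (i - 1) - ?S 0) \<le> cmod (?S i - ?S (i - 1)) + cmod (?S i - ?S 0)"
      using norm_triangle_ineq[of "?S (i - 1) - ?S i" "?S i - ?S 0"]
      by (simp add: norm_minus_commute)
    then show ?case using step[of "i - 1"] step2 by simp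
  qed simp
  then show ?thesis by simp
qed

lemma norm_sum_square_le:
  fixes v :: "'i \<Rightarrow> complex"
  shows "(cmod (\<Sum>i\<in>I. v i))\<^sup>2 \<le> real (card I) * (\<Sum>i\<in>I. (cmod (v i))\<^sup>2)"
proof -
  have "(cmod (\<Sum>i\<in>I. v i))\<^sup>2 \<le> (\<Sum>i\<in>I. cmod (v i))\<^sup>2"
    by (intro power_mono norm_sum) simp
  also have "\<dots> \<le> (\<Sum>i\<in>I. (cmod (v i))\<^sup>2) * card I"
    by (rule sum_squared_le_sum_of_squares)
  finally show ?thesis by (simp add: mult.commute)
qed

lemma norm_add_square_le: "(cmod (a + b))\<^sup>2 \<le> 2 * (cmod a)\<^sup>2 + 2 * (cmod b)\<^sup>2"
proof -
  have "(cmod (a + b))\<^sup>2 \<le> (cmod a + cmod b)\<^sup>2" by (intro power_mono norm_triangle_ineq) simp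
  also have "\<dots> \<le> 2 * (cmod a)\<^sup>2 + 2 * (cmod b)\<^sup>2"
    using sum_squares_bound[of "cmod a" "cmod b"] by (simp add: power2_sum)
  finally show ?thesis .
qed

text \<open>Average the sum over the shifts \<open>\<eta> s\<close>, at the cost of boundary terms which are \<open>O(1/N)\<close>, and apply
  the Cauchy--Schwarz inequality to the outer sum.\<close>

lemma van_der_corput_pointwise:
  fixes u :: "int \<Rightarrow> complex" and \<eta> :: "nat \<Rightarrow> int"
  assumes u: "\<And>n. cmod (u n) \<le> 1" and "0 < H"
  shows "(cmod ((\<Sum>n = 1..N. u (int n)) / N))\<^sup>2
    \<le> 2 / (real H)\<^sup>2 * ((\<Sum>n = 1..N. (cmod (\<Sum>s<H. u (int n + \<eta> s)))\<^sup>2) / N)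
      + 2 * ((\<Sum>s<H. 2 * \<bar>of_int (\<eta> s)\<bar>) / (real H * N))\<^sup>2"
proof (cases "N = 0")
  case False
  let ?A = "\<Sum>n = 1..N. u (int n)"
  let ?S = "\<Sum>n = 1..N. \<Sum>s<H. u (int n + \<eta> s)"
  have HN: "of_nat H * of_nat N \<noteq> (0::complex)" using \<open>0 < H\<close> False by simp
  have "of_nat H * ?A - ?S = (\<Sum>s<H. ?A - (\<Sum>n = 1..N. u (int n + \<eta> s)))"
    by (subst sum.swap) (simp add: sum_subtractf)
  also have "cmod \<dots> \<le> (\<Sum>s<H. 2 * \<bar>of_int (\<eta> s)\<bar>)"
    by (rule sum_norm_le) (use norm_shifted_sum_diff_le[of u] u in \<open>simp add: norm_minus_commute\<close>)
  finally have err: "cmod (of_nat H * ?A - ?S) \<le> (\<Sum>s<H. 2 * \<bar>of_int (\<eta> s)\<bar>)" .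
  have "?A / N = ?S / (H * N) + (of_nat H * ?A - ?S) / (H * N)"
    using HN by (simp add: field_simps)
  then have "(cmod (?A / N))\<^sup>2 \<le> 2 * (cmod (?S / (H * N)))\<^sup>2 + 2 * (cmod ((of_nat H * ?A - ?S) / (H * N)))\<^sup>2"
    using norm_add_square_le by metis
  also have "(cmod ((of_nat H * ?A - ?S) / (H * N)))\<^sup>2 \<le> ((\<Sum>s<H. 2 * \<bar>of_int (\<eta> s)\<bar>) / (real H * N))\<^sup>2"
    using err by (intro power_mono) (auto simp: norm_divide norm_mult intro!: divide_right_mono)
  also have "(cmod (?S / (H * N)))\<^sup>2 \<le> 1 / (real H)\<^sup>2 * ((\<Sum>n = 1..N. (cmod (\<Sum>s<H. u (int n + \<eta> s)))\<^sup>2) / N)"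
  proof -
    have "(cmod (?S / (H * N)))\<^sup>2 = (cmod ?S)\<^sup>2 / (real H * N)\<^sup>2"
      by (simp add: norm_divide norm_mult power_divide)
    also have "\<dots> \<le> (N * (\<Sum>n = 1..N. (cmod (\<Sum>s<H. u (int n + \<eta> s)))\<^sup>2)) / (real H * N)\<^sup>2"
      using norm_sum_square_le[of "\<lambda>n. \<Sum>s<H. u (int n + \<eta> s)" "{1..N}"]
      by (intro divide_right_mono) auto
    also have "\<dots> = 1 / (real H)\<^sup>2 * ((\<Sum>n = 1..N. (cmod (\<Sum>s<H. u (int n + \<eta> s)))\<^sup>2) / N)"
      using False \<open>0 < H\<close> by (simp add: power2_eq_square field_simps)
    finally show ?thesis .
  qed
  finally show ?thesis by simp
qed simp

context prob_space begin

text \<open>Expanding the square of the inner sum in the pointwise inequality and integrating leaves the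
  correlations over all pairs of shifts. The shifts are free: they only have to make the
  correlations small on average, which allows avoiding finitely many bad differences. The
  functions may depend on \<open>N\<close>.\<close>

lemma van_der_corput:
  fixes U :: "nat \<Rightarrow> int \<Rightarrow> 'a \<Rightarrow> complex"
  assumes U: "\<And>N n. bdd_meas M 1 (U N n)"
    and key: "\<And>e. e > 0 \<Longrightarrow> \<exists>H \<eta> g. 0 < H \<and>
      (\<forall>s<H. \<forall>t<H. \<forall>\<^sub>F N in sequentially.
        cmod ((\<Sum>n = 1..N. \<integral>x. U N (int n + \<eta> s) x * cnj (U N (int n + \<eta> t) x) \<partial>M) / N) \<le> g s t)
      \<and> (\<Sum>s<H. \<Sum>t<H. g s t) \<le> e * (real H)\<^sup>2"
  shows "(\<lambda>N. \<integral>x. (cmod ((\<Sum>n = 1..N. U N (int n) x) / N))\<^sup>2 \<partial>M) \<longlonglongrightarrow> 0"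
proof (rule order_tendstoI)
  fix a :: real assume "a < 0"
  show "\<forall>\<^sub>F N in sequentially. a < (\<integral>x. (cmod ((\<Sum>n = 1..N. U N (int n) x) / N))\<^sup>2 \<partial>M)"
    by (intro always_eventually allI less_le_trans[OF \<open>a < 0\<close>] Bochner_Integration.integral_nonneg)
       simp
next
  fix e :: real assume "0 < e"
  then have "e / 4 > 0" by simp
  from key[OF this] obtain H \<eta> g where H: "0 < H"
    and ev: "\<And>s t. s < H \<Longrightarrow> t < H \<Longrightarrow> \<forall>\<^sub>F N in sequentially.
        cmod ((\<Sum>n = 1..N. \<integral>x. U N (int n + \<eta> s) x * cnj (U N (int n + \<eta> t) x) \<partial>M) / N) \<le> g s t"
    and g: "(\<Sum>s<H. \<Sum>t<H. g s t) \<le> e / 4 * (real H)\<^sup>2" by blast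
  have Um[measurable]: "U N n \<in> borel_measurable M" for N n using U by (auto simp: bdd_meas_def)
  have UB: "cmod (U N n x) \<le> 1" if "x \<in> space M" for N n x using U that by (auto simp: bdd_meas_def)
  define c where "c N s t = (\<Sum>n = 1..N. \<integral>x. U N (int n + \<eta> s) x * cnj (U N (int n + \<eta> t) x) \<partial>M) / N"
    for N s t
  define E where "E = (\<Sum>s<H. 2 * \<bar>real_of_int (\<eta> s)\<bar>)"
  have bound: "(\<integral>x. (cmod ((\<Sum>n = 1..N. U N (int n) x) / N))\<^sup>2 \<partial>M)
      \<le> 2 / (real H)\<^sup>2 * (\<Sum>s<H. \<Sum>t<H. cmod (c N s t)) + 2 * (E / (real H * N))\<^sup>2" for N
  proof -
    have sumB: "cmod (\<Sum>s<H. U N (int n + \<eta> s) x) \<le> H" if "x \<in> space M" for n x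
      using sum_norm_le[of "{..<H}" "\<lambda>s. U N (int n + \<eta> s) x" "\<lambda>_. 1"] UB[OF that] by simp
    have int: "integrable M (\<lambda>x. (cmod (\<Sum>s<H. U N (int n + \<eta> s) x))\<^sup>2)" for n
      by (rule integrable_bdd[where B = "(real H)\<^sup>2"]) (use sumB in \<open>auto intro: power_mono\<close>)
    have int2: "integrable M (\<lambda>x. U N a x * cnj (U N b x))" for a b
      by (rule integrable_bdd[where B = 1]) (use UB in \<open>auto simp: norm_mult mult_le_one\<close>)
    have ptw: "(cmod ((\<Sum>n = 1..N. U N (int n) x) / N))\<^sup>2
        \<le> 2 / (real H)\<^sup>2 * ((\<Sum>n = 1..N. (cmod (\<Sum>s<H. U N (int n + \<eta> s) x))\<^sup>2) / N)
          + 2 * (E / (real H * N))\<^sup>2" if "x \<in> space M" for x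
      unfolding E_def by (rule van_der_corput_pointwise[of "\<lambda>n. U N n x", OF UB[OF that] H])
    have "(\<integral>x. (cmod ((\<Sum>n = 1..N. U N (int n) x) / N))\<^sup>2 \<partial>M)
      \<le> (\<integral>x. 2 / (real H)\<^sup>2 * ((\<Sum>n = 1..N. (cmod (\<Sum>s<H. U N (int n + \<eta> s) x))\<^sup>2) / N)
          + 2 * (E / (real H * N))\<^sup>2 \<partial>M)"
    proof (rule integral_mono_AE')
      show "integrable M (\<lambda>x. 2 / (real H)\<^sup>2 * ((\<Sum>n = 1..N. (cmod (\<Sum>s<H. U N (int n + \<eta> s) x))\<^sup>2) / N)
          + 2 * (E / (real H * N))\<^sup>2)"
        by (intro Bochner_Integration.integrable_add integrable_mult_right integrable_divide_zero
              Bochner_Integration.integrable_sum int) auto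
    qed (use ptw in \<open>auto intro!: AE_I2 add_nonneg_nonneg divide_nonneg_nonneg mult_nonneg_nonneg sum_nonneg\<close>)
    also have "\<dots> = 2 / (real H)\<^sup>2 * ((\<Sum>n = 1..N. \<integral>x. (cmod (\<Sum>s<H. U N (int n + \<eta> s) x))\<^sup>2 \<partial>M) / N)
          + 2 * (E / (real H * N))\<^sup>2"
      using int by (simp add: prob_space)
    also have "(\<Sum>n = 1..N. \<integral>x. (cmod (\<Sum>s<H. U N (int n + \<eta> s) x))\<^sup>2 \<partial>M) / N
        \<le> (\<Sum>s<H. \<Sum>t<H. cmod (c N s t))"
    proof -
      have one: "complex_of_real (\<integral>x. (cmod (\<Sum>s<H. U N (int n + \<eta> s) x))\<^sup>2 \<partial>M)
          = (\<Sum>s<H. \<Sum>t<H. \<integral>x. U N (int n + \<eta> s) x * cnj (U N (int n + \<eta> t) x) \<partial>M)" for n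
      proof -
        have "complex_of_real ((cmod (\<Sum>s<H. U N (int n + \<eta> s) x))\<^sup>2)
          = (\<Sum>s<H. \<Sum>t<H. U N (int n + \<eta> s) x * cnj (U N (int n + \<eta> t) x))" for x
          unfolding complex_norm_square by (simp add: sum_product cnj_sum)
        then show ?thesis
          unfolding integral_complex_of_real[symmetric]
          using int2 by (simp add: Bochner_Integration.integral_sum Bochner_Integration.integrable_sum)
      qed
      have "complex_of_real ((\<Sum>n = 1..N. \<integral>x. (cmod (\<Sum>s<H. U N (int n + \<eta> s) x))\<^sup>2 \<partial>M) / N)
          = (\<Sum>n = 1..N. \<Sum>s<H. \<Sum>t<H. \<integral>x. U N (int n + \<eta> s) x * cnj (U N (int n + \<eta> t) x) \<partial>M) / N"
        by (simp add: one)
      also have "\<dots> = (\<Sum>s<H. \<Sum>t<H. c N s t)"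
        unfolding c_def sum_divide_distrib
        by (simp only: sum.swap[of _ "{..<H}" "{1..N}"])
      finally have eq: "complex_of_real ((\<Sum>n = 1..N. \<integral>x. (cmod (\<Sum>s<H. U N (int n + \<eta> s) x))\<^sup>2 \<partial>M) / N)
          = (\<Sum>s<H. \<Sum>t<H. c N s t)" .
      have "(\<Sum>n = 1..N. \<integral>x. (cmod (\<Sum>s<H. U N (int n + \<eta> s) x))\<^sup>2 \<partial>M) / N
          \<le> cmod (\<Sum>s<H. \<Sum>t<H. c N s t)"
        unfolding eq[symmetric] norm_of_real by (rule abs_ge_self)
      also have "\<dots> \<le> (\<Sum>s<H. \<Sum>t<H. cmod (c N s t))"
        by (intro sum_norm_le order_refl)
      finally show ?thesis .
    qed
    finally show ?thesis by this (intro add_right_mono mult_left_mono, auto)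
  qed
  have "\<forall>\<^sub>F N in sequentially. \<forall>s\<in>{..<H}. \<forall>t\<in>{..<H}. cmod (c N s t) \<le> g s t"
    using ev unfolding c_def by (intro eventually_ball_finite ballI) auto
  moreover have "(\<lambda>N. 2 * (E / (real H * real N))\<^sup>2) \<longlonglongrightarrow> 2 * 0\<^sup>2"
  proof (intro tendsto_intros)
    have "(\<lambda>N. (E / real H) / real N) \<longlonglongrightarrow> 0"
      by (intro tendsto_divide_0[OF tendsto_const] filterlim_at_top_imp_at_infinity
            filterlim_real_sequentially)
    then show "(\<lambda>N. E / (real H * real N)) \<longlonglongrightarrow> 0" by (simp add: divide_divide_eq_left)
  qed
  then have "\<forall>\<^sub>F N in sequentially. 2 * (E / (real H * real N))\<^sup>2 < e / 2"
    by (rule order_tendstoD(2)) (use \<open>0 < e\<close> in simp)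
  ultimately show "\<forall>\<^sub>F N in sequentially. (\<integral>x. (cmod ((\<Sum>n = 1..N. U N (int n) x) / N))\<^sup>2 \<partial>M) < e"
  proof eventually_elim
    case (elim N)
    have "(\<Sum>s<H. \<Sum>t<H. cmod (c N s t)) \<le> (\<Sum>s<H. \<Sum>t<H. g s t)"
      using elim(1) by (intro sum_mono) auto
    then have "(\<Sum>s<H. \<Sum>t<H. cmod (c N s t)) \<le> e / 4 * (real H)\<^sup>2" using g by simp
    then have "2 / (real H)\<^sup>2 * (\<Sum>s<H. \<Sum>t<H. cmod (c N s t)) \<le> 2 / (real H)\<^sup>2 * (e / 4 * (real H)\<^sup>2)"
      by (intro mult_left_mono) auto
    also have "\<dots> = e / 2" using H by simp
    finally show ?case using bound[of N] elim(2) by linarith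
  qed
qed

end

section \<open>Bounded functions and mean square convergence\<close>

context prob_space begin

definition bdd :: "('a \<Rightarrow> complex) \<Rightarrow> bool" where
  "bdd f \<longleftrightarrow> (\<exists>B. bdd_meas M B f)"

lemma bddI: "f \<in> borel_measurable M \<Longrightarrow> (\<And>x. x \<in> space M \<Longrightarrow> cmod (f x) \<le> B) \<Longrightarrow> bdd f"
  unfolding bdd_def bdd_meas_def by blast

lemma bddE:
  assumes "bdd f"
  obtains B where "f \<in> borel_measurable M" "\<And>x. x \<in> space M \<Longrightarrow> cmod (f x) \<le> B"
  using assms unfolding bdd_def bdd_meas_def by blast

lemma bdd_meas_imp_bdd: "bdd_meas M B f \<Longrightarrow> bdd f"
  unfolding bdd_def by blast

lemma bdd_measurable: "bdd f \<Longrightarrow> f \<in> borel_measurable M"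
  by (elim bddE)

lemma bdd_const: "bdd (\<lambda>x. c)"
  by (rule bddI[where B = "cmod c"]) auto

lemma bdd_add:
  assumes "bdd f" "bdd g" shows "bdd (\<lambda>x. f x + g x)"
proof -
  obtain B C where "f \<in> borel_measurable M" "\<And>x. x \<in> space M \<Longrightarrow> cmod (f x) \<le> B"
    "g \<in> borel_measurable M" "\<And>x. x \<in> space M \<Longrightarrow> cmod (g x) \<le> C"
    using assms by (metis bddE)
  then show ?thesis by (intro bddI[where B = "B + C"] norm_triangle_mono) auto
qed

lemma bdd_mult:
  assumes "bdd f" "bdd g" shows "bdd (\<lambda>x. f x * g x)"
proof -
  obtain B C where "f \<in> borel_measurable M" "\<And>x. x \<in> space M \<Longrightarrow> cmod (f x) \<le> B"
    "g \<in> borel_measurable M" "\<And>x. x \<in> space M \<Longrightarrow> cmod (g x) \<le> C"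
    using assms by (metis bddE)
  then show ?thesis by (intro bddI[where B = "B * C"]) (auto simp: norm_mult intro!: mult_mono')
qed

lemma bdd_cnj: "bdd f \<Longrightarrow> bdd (\<lambda>x. cnj (f x))"
  by (elim bddE, rule bddI) auto

lemma bdd_diff: "bdd f \<Longrightarrow> bdd g \<Longrightarrow> bdd (\<lambda>x. f x - g x)"
  using bdd_add[of f "\<lambda>x. (-1) * g x"] bdd_mult[OF bdd_const[of "-1"], of g] by simp

lemma bdd_sum: "(\<And>i. i \<in> I \<Longrightarrow> bdd (f i)) \<Longrightarrow> bdd (\<lambda>x. \<Sum>i\<in>I. f i x)"
  by (induction I rule: infinite_finite_induct) (auto intro: bdd_const bdd_add)

lemma bdd_prod: "(\<And>i. i \<in> I \<Longrightarrow> bdd (f i)) \<Longrightarrow> bdd (\<lambda>x. \<Prod>i\<in>I. f i x)"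
  by (induction I rule: infinite_finite_induct) (auto intro: bdd_const bdd_mult)

lemma bdd_divide_const: "bdd f \<Longrightarrow> bdd (\<lambda>x. f x / c)"
  using bdd_mult[OF _ bdd_const[of "inverse c"], of f] by (simp add: divide_inverse)

lemma bdd_compose: "T \<in> M \<rightarrow>\<^sub>M M \<Longrightarrow> bdd f \<Longrightarrow> bdd (\<lambda>x. f (T x))"
  by (elim bddE, rule bddI) (auto dest: measurable_space intro: measurable_compose)

lemma bdd_integrable: "bdd f \<Longrightarrow> integrable M f"
  by (elim bddE) (rule integrable_bdd)

lemma bdd_integrable_norm_square:
  assumes "bdd f" shows "integrable M (\<lambda>x. (cmod (f x))\<^sup>2)"
proof -
  obtain B where "f \<in> borel_measurable M" "\<And>x. x \<in> space M \<Longrightarrow> cmod (f x) \<le> B"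
    using assms by (metis bddE)
  then show ?thesis by (intro integrable_bdd[where B = "B\<^sup>2"]) (auto intro: power_mono)
qed

definition L2_null :: "(nat \<Rightarrow> 'a \<Rightarrow> complex) \<Rightarrow> bool" where
  "L2_null F \<longleftrightarrow> (\<lambda>N. \<integral>x. (cmod (F N x))\<^sup>2 \<partial>M) \<longlonglongrightarrow> 0"

lemma L2_null_add:
  assumes "L2_null F" "L2_null G" and bF: "\<And>N. bdd (F N)" and bG: "\<And>N. bdd (G N)"
  shows "L2_null (\<lambda>N x. F N x + G N x)"
  unfolding L2_null_def
proof (rule tendsto_sandwich[OF _ _ tendsto_const])
  show "\<forall>\<^sub>F N in sequentially. 0 \<le> (\<integral>x. (cmod (F N x + G N x))\<^sup>2 \<partial>M)"
    by (intro always_eventually allI Bochner_Integration.integral_nonneg) simp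
  have "(\<lambda>N. 2 * (\<integral>x. (cmod (F N x))\<^sup>2 \<partial>M) + 2 * (\<integral>x. (cmod (G N x))\<^sup>2 \<partial>M)) \<longlonglongrightarrow> 2 * 0 + 2 * 0"
    using assms(1,2) unfolding L2_null_def by (intro tendsto_intros)
  then show "(\<lambda>N. 2 * (\<integral>x. (cmod (F N x))\<^sup>2 \<partial>M) + 2 * (\<integral>x. (cmod (G N x))\<^sup>2 \<partial>M)) \<longlonglongrightarrow> 0" by simp
  have "(\<integral>x. (cmod (F N x + G N x))\<^sup>2 \<partial>M)
      \<le> (\<integral>x. 2 * (cmod (F N x))\<^sup>2 + 2 * (cmod (G N x))\<^sup>2 \<partial>M)" for N
    using bdd_integrable_norm_square[OF bF] bdd_integrable_norm_square[OF bG]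
      bdd_integrable_norm_square[OF bdd_add[OF bF bG]]
    by (intro integral_mono norm_add_square_le) auto
  then show "\<forall>\<^sub>F N in sequentially. (\<integral>x. (cmod (F N x + G N x))\<^sup>2 \<partial>M)
      \<le> 2 * (\<integral>x. (cmod (F N x))\<^sup>2 \<partial>M) + 2 * (\<integral>x. (cmod (G N x))\<^sup>2 \<partial>M)"
    using bdd_integrable_norm_square[OF bF] bdd_integrable_norm_square[OF bG] by simp
qed

lemma L2_null_scale: "L2_null F \<Longrightarrow> L2_null (\<lambda>N x. c * F N x)"
  unfolding L2_null_def
  using tendsto_mult_right_zero[of "\<lambda>N. \<integral>x. (cmod (F N x))\<^sup>2 \<partial>M" sequentially "(cmod c)\<^sup>2"]
  by (simp add: norm_mult power_mult_distrib)

lemma norm_integral_square_le: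
  assumes "bdd f" shows "(cmod (\<integral>x. f x \<partial>M))\<^sup>2 \<le> (\<integral>x. (cmod (f x))\<^sup>2 \<partial>M)"
proof -
  have i1: "integrable M (\<lambda>x. cmod (f x))" using bdd_integrable[OF assms] by simp
  have i2: "integrable M (\<lambda>x. (cmod (f x))\<^sup>2)" by (rule bdd_integrable_norm_square[OF assms])
  have "(cmod (\<integral>x. f x \<partial>M))\<^sup>2 \<le> (\<integral>x. cmod (f x) \<partial>M)\<^sup>2"
    by (intro power_mono) simp_all
  also have "\<dots> \<le> (\<integral>x. (cmod (f x))\<^sup>2 \<partial>M)"
    using variance_positive[of "\<lambda>x. cmod (f x)"] variance_eq[OF i1 i2] by simp
  finally show ?thesis .
qed

end

section \<open>Averages along a family of maps into an acting group\<close>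

text \<open>A subgroup \<open>V\<close> of a free abelian group that acts by weakly mixing maps. It is a subgroup and not
  the whole group because the additional transformations of the theorem commute only with the maps
  generated by \<open>T 1, \<dots>, T k\<close>.\<close>

locale mixing_action = prob_space M for M :: "'a measure" +
  fixes V :: "('b \<Rightarrow>\<^sub>0 int) set" and \<alpha> :: "('b \<Rightarrow>\<^sub>0 int) \<Rightarrow> 'a \<Rightarrow> 'a"
  assumes zero_in: "0 \<in> V"
    and \<alpha>_zero: "x \<in> space M \<Longrightarrow> \<alpha> 0 x = x"
    and diff_in: "u \<in> V \<Longrightarrow> v \<in> V \<Longrightarrow> u - v \<in> V"
    and \<alpha>_mp: "v \<in> V \<Longrightarrow> measure_preserving_map M (\<alpha> v)"
    and \<alpha>_add: "u \<in> V \<Longrightarrow> v \<in> V \<Longrightarrow> x \<in> space M \<Longrightarrow> \<alpha> (u + v) x = \<alpha> u (\<alpha> v x)"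
    and \<alpha>_wm: "v \<in> V \<Longrightarrow> v \<noteq> 0 \<Longrightarrow> weakly_mixing M (\<alpha> v)"
begin

lemma \<alpha>_measurable: "v \<in> V \<Longrightarrow> \<alpha> v \<in> M \<rightarrow>\<^sub>M M"
  using \<alpha>_mp by (simp add: measure_preserving_map_def)

lemma \<alpha>_space: "v \<in> V \<Longrightarrow> x \<in> space M \<Longrightarrow> \<alpha> v x \<in> space M"
  using measurable_space[OF \<alpha>_measurable] .

lemma add_in: "u \<in> V \<Longrightarrow> v \<in> V \<Longrightarrow> u + v \<in> V"
  using diff_in[of u "0 - v"] diff_in[OF zero_in, of v] by simp

lemma cmul_in: "v \<in> V \<Longrightarrow> frag_cmul n v \<in> V"
proof (induction n rule: int_induct[where k = 0])
  case (step1 i)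
  then show ?case by (simp add: frag_cmul_distrib add_in)
next
  case (step2 i)
  then show ?case by (simp add: frag_cmul_diff_distrib diff_in)
qed (simp add: zero_in)

lemma \<alpha>_funpow:
  assumes "v \<in> V" "x \<in> space M"
  shows "(\<alpha> v ^^ n) x = \<alpha> (frag_cmul (int n) v) x"
proof (induction n)
  case (Suc n)
  have "\<alpha> (v + frag_cmul (int n) v) x = \<alpha> v (\<alpha> (frag_cmul (int n) v) x)"
    by (rule \<alpha>_add[OF assms(1) cmul_in[OF assms(1)] assms(2)])
  then show ?case using Suc by (simp add: frag_cmul_distrib)
qed (simp add: \<alpha>_zero assms(2))

definition commuting :: "('a \<Rightarrow> 'a) \<Rightarrow> bool" where
  "commuting S \<longleftrightarrow> measure_preserving_map M S \<and> (\<forall>v\<in>V. \<forall>x\<in>space M. S (\<alpha> v x) = \<alpha> v (S x))"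

lemma commuting_measurable: "commuting S \<Longrightarrow> S \<in> M \<rightarrow>\<^sub>M M"
  by (simp add: commuting_def measure_preserving_map_def)

lemma commuting_swap: "commuting S \<Longrightarrow> v \<in> V \<Longrightarrow> x \<in> space M \<Longrightarrow> S (\<alpha> v x) = \<alpha> v (S x)"
  by (simp add: commuting_def)

text \<open>The maps \<open>S i N\<close> may vary arbitrarily with \<open>N\<close>; this is where the powers \<open>Q i j (N)\<close> enter.\<close>

definition orbit_prod ::
  "nat set \<Rightarrow> (nat \<Rightarrow> int \<Rightarrow> 'b \<Rightarrow>\<^sub>0 int) \<Rightarrow> (nat \<Rightarrow> 'a \<Rightarrow> complex) \<Rightarrow> (nat \<Rightarrow> nat \<Rightarrow> 'a \<Rightarrow> 'a)
    \<Rightarrow> nat \<Rightarrow> int \<Rightarrow> 'a \<Rightarrow> complex" where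
  "orbit_prod I p f S N n x = (\<Prod>i\<in>I. f i (S i N (\<alpha> (p i n) x)))"

definition avg ::
  "nat set \<Rightarrow> (nat \<Rightarrow> int \<Rightarrow> 'b \<Rightarrow>\<^sub>0 int) \<Rightarrow> (nat \<Rightarrow> 'a \<Rightarrow> complex) \<Rightarrow> (nat \<Rightarrow> nat \<Rightarrow> 'a \<Rightarrow> 'a)
    \<Rightarrow> nat \<Rightarrow> 'a \<Rightarrow> complex" where
  "avg I p f S N x = (\<Sum>n = 1..N. orbit_prod I p f S N (int n) x) / of_nat N"

text \<open>The bound \<open>1\<close> keeps all products of functions and of their integrals bounded by \<open>1\<close> during
  differencing.\<close>

definition mean_zero_averages_vanish :: "nat set \<Rightarrow> (nat \<Rightarrow> int \<Rightarrow> 'b \<Rightarrow>\<^sub>0 int) \<Rightarrow> bool" where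
  "mean_zero_averages_vanish I p \<longleftrightarrow>
    (\<forall>f S. (\<forall>i\<in>I. bdd_meas M 1 (f i)) \<longrightarrow> (\<forall>i\<in>I. \<forall>N. commuting (S i N)) \<longrightarrow>
       (\<exists>i\<in>I. (\<integral>x. f i x \<partial>M) = 0) \<longrightarrow> L2_null (avg I p f S))"

definition averages_converge :: "nat set \<Rightarrow> (nat \<Rightarrow> int \<Rightarrow> 'b \<Rightarrow>\<^sub>0 int) \<Rightarrow> bool" where
  "averages_converge I p \<longleftrightarrow>
    (\<forall>f S. (\<forall>i\<in>I. bdd (f i)) \<longrightarrow> (\<forall>i\<in>I. \<forall>N. commuting (S i N)) \<longrightarrow>
       L2_null (\<lambda>N x. avg I p f S N x - (\<Prod>i\<in>I. \<integral>y. f i y \<partial>M)))"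

lemma orbit_map_measurable:
  "commuting S \<Longrightarrow> v \<in> V \<Longrightarrow> (\<lambda>x. S (\<alpha> v x)) \<in> M \<rightarrow>\<^sub>M M"
  by (rule measurable_compose[OF \<alpha>_measurable commuting_measurable])

lemma bdd_avg:
  assumes "\<And>i n. i \<in> I \<Longrightarrow> p i n \<in> V" and "\<And>i. i \<in> I \<Longrightarrow> bdd (f i)"
    and "\<And>i N. i \<in> I \<Longrightarrow> commuting (S i N)"
  shows "bdd (avg I p f S N)"
proof -
  have "bdd (\<lambda>x. f i (S i N (\<alpha> (p i n) x)))" if "i \<in> I" for i n
    by (rule bdd_compose[OF orbit_map_measurable]) (use assms that in auto)
  then have "bdd (\<lambda>x. avg I p f S N x)" unfolding avg_def orbit_prod_def
    by (intro bdd_divide_const bdd_sum bdd_prod)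
  then show ?thesis .
qed

lemma mean_zero_averages_vanish_bdd:
  assumes "finite I" and mz: "mean_zero_averages_vanish I p"
    and f: "\<And>i. i \<in> I \<Longrightarrow> bdd (f i)" and S: "\<And>i N. i \<in> I \<Longrightarrow> commuting (S i N)"
    and zero: "\<exists>i\<in>I. (\<integral>x. f i x \<partial>M) = 0"
  shows "L2_null (avg I p f S)"
proof -
  obtain B where B: "\<And>i. i \<in> I \<Longrightarrow> bdd_meas M (B i) (f i)" using f unfolding bdd_def by metis
  define C where "C = 1 + (\<Sum>i\<in>I. \<bar>B i\<bar>)"
  have C: "C \<ge> 1" unfolding C_def by (simp add: sum_nonneg)
  have fC: "cmod (f i x) \<le> C" if "i \<in> I" "x \<in> space M" for i x
  proof -
    have "cmod (f i x) \<le> B i" using B[OF that(1)] that(2) by (simp add: bdd_meas_def)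
    also have "\<dots> \<le> (\<Sum>i\<in>I. \<bar>B i\<bar>)"
      using member_le_sum[of i I "\<lambda>i. \<bar>B i\<bar>"] that(1) \<open>finite I\<close> by simp
    finally show ?thesis unfolding C_def by simp
  qed
  let ?g = "\<lambda>i x. f i x / of_real C"
  have "bdd_meas M 1 (?g i)" if "i \<in> I" for i
    using B[OF that] fC[OF that] C by (auto simp: bdd_meas_def norm_divide)
  moreover have "\<exists>i\<in>I. (\<integral>x. ?g i x \<partial>M) = 0" using zero by auto
  ultimately have "L2_null (avg I p ?g S)"
    by (intro mz[unfolded mean_zero_averages_vanish_def, rule_format] S)
  from L2_null_scale[OF this, of "of_real C ^ card I"] show ?thesis
    using C by (simp add: avg_def[abs_def] orbit_prod_def prod_dividef sum_divide_distrib[symmetric])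
qed

text \<open>Replace the functions by their means one at a time. Each replacement changes the average by an
  average whose corresponding function is \<open>f j\<close> minus its mean, and when all functions are constant the
  average is the product of the means.\<close>

lemma averages_converge_if_mean_zero_vanish:
  assumes fin: "finite I" and V: "\<And>i n. i \<in> I \<Longrightarrow> p i n \<in> V" and mz: "mean_zero_averages_vanish I p"
  shows "averages_converge I p"
  unfolding averages_converge_def
proof (intro allI impI)
  fix f and S :: "nat \<Rightarrow> nat \<Rightarrow> 'a \<Rightarrow> 'a"
  assume f0: "\<forall>i\<in>I. bdd (f i)" and S0: "\<forall>i\<in>I. \<forall>N. commuting (S i N)"
  have f: "\<And>i. i \<in> I \<Longrightarrow> bdd (f i)" and S: "\<And>i N. i \<in> I \<Longrightarrow> commuting (S i N)"
    using f0 S0 by auto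
  define c where "c i = (\<integral>x. f i x \<partial>M)" for i
  define g where "g J i = (if i \<in> J then (\<lambda>x. c i) else f i)" for J i
  have bg: "bdd (g J i)" if "i \<in> I" for J i using f[OF that] by (simp add: g_def bdd_const)
  have bavg: "bdd (avg I p (g J) S N)" for J N by (rule bdd_avg) (use V bg S in auto)
  have tele: "L2_null (\<lambda>N x. avg I p f S N x - avg I p (g J) S N x)" if "finite J" "J \<subseteq> I" for J
    using that
  proof (induction J rule: finite_induct)
    case empty
    have "g {} = f" by (simp add: g_def fun_eq_iff)
    then show ?case by (simp add: L2_null_def)
  next
    case (insert j J)
    have j: "j \<in> I" using insert by simp
    let ?d = "(g J)(j := \<lambda>x. f j x - c j)"
    have "avg I p (g J) S N x - avg I p (g (insert j J)) S N x = avg I p ?d S N x" for N x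
    proof -
      have "orbit_prod I p (g J) S N n x - orbit_prod I p (g (insert j J)) S N n x
          = orbit_prod I p ?d S N n x" for n
      proof -
        have split: "orbit_prod I p h S N n x
            = h j (S j N (\<alpha> (p j n) x)) * (\<Prod>i\<in>I - {j}. h i (S i N (\<alpha> (p i n) x)))" for h
          unfolding orbit_prod_def by (rule prod.remove[OF fin j])
        have "(\<Prod>i\<in>I - {j}. h i (S i N (\<alpha> (p i n) x))) = (\<Prod>i\<in>I - {j}. g J i (S i N (\<alpha> (p i n) x)))"
          if "\<And>i. i \<noteq> j \<Longrightarrow> h i = g J i" for h
          using that by (intro prod.cong) auto
        note eq = this[of ?d] this[of "g (insert j J)"]
        show ?thesis
          unfolding split[of "g J"] split[of "g (insert j J)"] split[of ?d]
          using eq insert.hyps(2) by (simp add: g_def algebra_simps)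
      qed
      then show ?thesis unfolding avg_def by (simp add: diff_divide_distrib[symmetric] sum_subtractf[symmetric])
    qed
    moreover have "L2_null (avg I p ?d S)"
    proof (rule mean_zero_averages_vanish_bdd[OF fin mz])
      show "bdd (?d i)" if "i \<in> I" for i
        using bg[OF that] bdd_diff[OF f[OF j] bdd_const] by simp
      have "(\<integral>x. ?d j x \<partial>M) = 0"
        using bdd_integrable[OF f[OF j]] by (simp add: c_def prob_space)
      then show "\<exists>i\<in>I. (\<integral>x. ?d i x \<partial>M) = 0" using j by blast
    qed (use S in auto)
    ultimately have "L2_null (\<lambda>N x. avg I p (g J) S N x - avg I p (g (insert j J)) S N x)" by simp
    with insert have
      "L2_null (\<lambda>N x. (avg I p f S N x - avg I p (g J) S N x)
         + (avg I p (g J) S N x - avg I p (g (insert j J)) S N x))"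
      by (intro L2_null_add bdd_diff bavg bdd_avg V f S) auto
    then show ?case by simp
  qed
  have "avg I p (g I) S N x = (\<Prod>i\<in>I. c i)" if "N > 0" for N x
    using that by (simp add: avg_def orbit_prod_def g_def)
  then have "\<forall>\<^sub>F N in sequentially. (\<integral>x. (cmod (avg I p f S N x - avg I p (g I) S N x))\<^sup>2 \<partial>M)
      = (\<integral>x. (cmod (avg I p f S N x - (\<Prod>i\<in>I. c i)))\<^sup>2 \<partial>M)"
    by (intro eventually_mono[OF eventually_gt_at_top[of 0]]) simp
  from tendsto_cong[OF this] tele[OF fin order_refl]
  show "L2_null (\<lambda>N x. avg I p f S N x - (\<Prod>i\<in>I. \<integral>y. f i y \<partial>M))"
    unfolding L2_null_def c_def by simp
qed

end

section \<open>Differencing a family\<close>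

context mixing_action begin

definition admissible :: "nat set \<Rightarrow> (nat \<Rightarrow> int \<Rightarrow> 'b \<Rightarrow>\<^sub>0 int) \<Rightarrow> bool" where
  "admissible I p \<longleftrightarrow> finite I
    \<and> (\<forall>i\<in>I. (\<exists>d. poly_deg_le d (p i)) \<and> (\<forall>n. p i n \<in> V) \<and> \<not> poly_deg_le 0 (p i))
    \<and> (\<forall>i\<in>I. \<forall>j\<in>I. i \<noteq> j \<longrightarrow> \<not> poly_deg_le 0 (\<lambda>n. p i n - p j n))"

text \<open>Indices of the differenced family: \<open>2 * i\<close> stands for the translate of \<open>p i\<close> by \<open>h\<close>, and \<open>2 * i + 1\<close> for
  that by \<open>h'\<close>. The second translate of an affine \<open>p i\<close> is absent, since it is merged with the first,
  and the first translate of \<open>p q\<close> becomes \<open>0\<close> and leaves the family.\<close>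

definition vdc_index :: "nat \<Rightarrow> nat set \<Rightarrow> (nat \<Rightarrow> int \<Rightarrow> 'b \<Rightarrow>\<^sub>0 int) \<Rightarrow> nat set" where
  "vdc_index q I p = (\<lambda>i. 2 * i) ` (I - {q}) \<union> (\<lambda>i. 2 * i + 1) ` {i \<in> I. \<not> poly_deg_le 1 (p i)}"

definition vdc_poly ::
  "nat \<Rightarrow> int \<Rightarrow> int \<Rightarrow> (nat \<Rightarrow> int \<Rightarrow> 'b \<Rightarrow>\<^sub>0 int) \<Rightarrow> nat \<Rightarrow> int \<Rightarrow> 'b \<Rightarrow>\<^sub>0 int" where
  "vdc_poly q h h' p j n = p (j div 2) (n + (if even j then h else h')) - p q (n + h)"

lemma vdc_index_prod:
  assumes "finite I"
  shows "(\<Prod>j\<in>vdc_index q I p. g j)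
    = (\<Prod>i\<in>I - {q}. g (2 * i)) * (\<Prod>i\<in>{i \<in> I. \<not> poly_deg_le 1 (p i)}. g (2 * i + 1))"
proof -
  have "(\<lambda>i. 2 * i) ` (I - {q}) \<inter> (\<lambda>i. 2 * i + 1) ` {i \<in> I. \<not> poly_deg_le 1 (p i)} = {}"
    by auto presburger
  then have "(\<Prod>j\<in>vdc_index q I p. g j) = (\<Prod>j\<in>(\<lambda>i. 2 * i) ` (I - {q}). g j)
      * (\<Prod>j\<in>(\<lambda>i. 2 * i + 1) ` {i \<in> I. \<not> poly_deg_le 1 (p i)}. g j)"
    unfolding vdc_index_def using assms by (intro prod.union_disjoint) auto
  also have "(\<Prod>j\<in>(\<lambda>i. 2 * i) ` (I - {q}). g j) = (\<Prod>i\<in>I - {q}. g (2 * i))"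
    by (subst prod.reindex) (auto simp: inj_on_def)
  also have "(\<Prod>j\<in>(\<lambda>i. 2 * i + 1) ` {i \<in> I. \<not> poly_deg_le 1 (p i)}. g j)
      = (\<Prod>i\<in>{i \<in> I. \<not> poly_deg_le 1 (p i)}. g (2 * i + 1))"
    by (subst prod.reindex) (auto simp: inj_on_def)
  finally show ?thesis .
qed

text \<open>The function attached to the translate of \<open>p\<close> by \<open>h\<close> after differencing, with \<open>t = h' - h\<close>: in the
  affine case it includes the factor of the translate by \<open>h'\<close>, as \<open>t\<close> times the slope \<open>p 1 - p 0\<close> is the
  constant by which the two differ.\<close>

definition self_corr :: "(int \<Rightarrow> 'b \<Rightarrow>\<^sub>0 int) \<Rightarrow> int \<Rightarrow> ('a \<Rightarrow> complex) \<Rightarrow> 'a \<Rightarrow> complex" where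
  "self_corr p t f = (if poly_deg_le 1 p then (\<lambda>x. f x * cnj (f (\<alpha> (frag_cmul t (p 1 - p 0)) x))) else f)"

text \<open>With \<open>y = \<alpha> (p q (n + h)) x\<close>, every factor on the left is a function of \<open>\<alpha> (p i (n + k) - p q (n + h)) y\<close>.
  For affine \<open>p i\<close> the maps \<open>S i N\<close> and \<open>\<alpha>\<close> have to be exchanged in order to merge its two factors.\<close>

lemma orbit_prod_correlation:
  fixes f :: "nat \<Rightarrow> 'a \<Rightarrow> complex" and h h' :: int
  assumes adm: "admissible I p" and "q \<in> I" and S: "\<And>i N. i \<in> I \<Longrightarrow> commuting (S i N)"
    and x: "x \<in> space M"
  defines "F \<equiv> \<lambda>i. self_corr (p i) (h' - h) (f i)"
  shows "orbit_prod I p f S N (n + h) x * cnj (orbit_prod I p f S N (n + h') x)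
    = F q (S q N (\<alpha> (p q (n + h)) x)) *
      orbit_prod (vdc_index q I p) (vdc_poly q h h' p)
        (\<lambda>j. if even j then F (j div 2) else (\<lambda>x. cnj (f (j div 2) x))) (\<lambda>j. S (j div 2)) N n
        (\<alpha> (p q (n + h)) x)"
proof -
  have fin: "finite I" and V: "\<And>i n. i \<in> I \<Longrightarrow> p i n \<in> V" using adm by (auto simp: admissible_def)
  let ?N = "{i \<in> I. \<not> poly_deg_le 1 (p i)}"
  let ?d = "p q (n + h)"
  let ?z = "\<lambda>i k. S i N (\<alpha> (p i (n + k)) x)"
  have move: "\<alpha> (p i (n + k) - ?d) (\<alpha> ?d x) = \<alpha> (p i (n + k)) x" if "i \<in> I" for i k
    using \<alpha>_add[OF diff_in[OF V[OF that] V[OF \<open>q \<in> I\<close>]] V[OF \<open>q \<in> I\<close>] x, of "n + k" "n + h" "n + h"]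
    by simp
  have F: "F i (?z i h) = f i (?z i h) * (if i \<in> ?N then 1 else cnj (f i (?z i h')))" if i: "i \<in> I" for i
  proof (cases "poly_deg_le 1 (p i)")
    case True
    let ?g = "frag_cmul (h' - h) (p i 1 - p i 0)"
    have g: "?g \<in> V" by (intro cmul_in diff_in V i)
    have "p i (n + h') = ?g + p i (n + h)"
      using poly_deg_le_1_affine[OF True, of "n + h" "h' - h"] by (simp add: add.commute)
    then have "?z i h' = \<alpha> ?g (?z i h)"
      using \<alpha>_add[OF g V[OF i] x] commuting_swap[OF S[OF i] g \<alpha>_space[OF V[OF i] x]] by simp
    then show ?thesis using True by (simp add: F_def self_corr_def)
  next
    case False
    then show ?thesis using i by (simp add: F_def self_corr_def)
  qed
  have "orbit_prod I p f S N (n + h) x * cnj (orbit_prod I p f S N (n + h') x)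
      = (\<Prod>i\<in>I. f i (?z i h) * cnj (f i (?z i h')))"
    by (simp add: orbit_prod_def cnj_prod prod.distrib)
  also have "\<dots> = (\<Prod>i\<in>I. F i (?z i h) * (if i \<in> ?N then cnj (f i (?z i h')) else 1))"
    by (rule prod.cong[OF refl]) (use F in auto)
  also have "\<dots> = (\<Prod>i\<in>I. F i (?z i h)) * (\<Prod>i\<in>?N. cnj (f i (?z i h')))"
    using fin by (simp add: prod.distrib prod.inter_filter[symmetric])
  also have "(\<Prod>i\<in>I. F i (?z i h)) = F q (?z q h) * (\<Prod>i\<in>I - {q}. F i (?z i h))"
    by (rule prod.remove[OF fin \<open>q \<in> I\<close>])
  finally show ?thesis
    unfolding orbit_prod_def vdc_index_prod[OF fin]
    by (simp add: vdc_poly_def move mult.assoc)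
qed

lemma bdd_self_corr:
  assumes "bdd f" and "\<And>n. p n \<in> V"
  shows "bdd (self_corr p t f)"
proof (cases "poly_deg_le 1 p")
  case True
  have "bdd (\<lambda>x. cnj (f (\<alpha> (frag_cmul t (p 1 - p 0)) x)))"
    by (intro bdd_cnj bdd_compose[OF \<alpha>_measurable] cmul_in diff_in assms)
  then show ?thesis using True bdd_mult[OF assms(1)] by (simp add: self_corr_def)
qed (use assms in \<open>simp add: self_corr_def\<close>)

text \<open>The map \<open>\<alpha> (p q (n + h))\<close> preserves the measure, so the averaged correlation is the integral of the function
  of index \<open>q\<close> against the average along the differenced family. The latter converges in \<open>L\<^sup>2\<close>,
  and the former has an integral that does not depend on \<open>N\<close>.\<close>

lemma correlations_converge:
  assumes adm: "admissible I p" and q: "q \<in> I"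
    and f: "\<And>i. i \<in> I \<Longrightarrow> bdd (f i)" and S: "\<And>i N. i \<in> I \<Longrightarrow> commuting (S i N)"
    and conv: "averages_converge (vdc_index q I p) (vdc_poly q h h' p)"
  shows "(\<lambda>N. (\<Sum>n = 1..N. \<integral>x. orbit_prod I p f S N (int n + h) x
              * cnj (orbit_prod I p f S N (int n + h') x) \<partial>M) / N)
    \<longlonglongrightarrow> (\<Prod>i\<in>I. \<integral>x. self_corr (p i) (h' - h) (f i) x \<partial>M)
        * (\<Prod>i\<in>{i \<in> I. \<not> poly_deg_le 1 (p i)}. cnj (\<integral>x. f i x \<partial>M))"
proof -
  let ?J = "vdc_index q I p" and ?r = "vdc_poly q h h' p"
  have fin: "finite I" and V: "\<And>i n. i \<in> I \<Longrightarrow> p i n \<in> V" using adm by (auto simp: admissible_def)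
  define F where "F = (\<lambda>i. self_corr (p i) (h' - h) (f i))"
  define f' where "f' = (\<lambda>j. if even j then F (j div 2) else (\<lambda>x. cnj (f (j div 2) x)))"
  define S' where "S' = (\<lambda>j::nat. S (j div 2))"
  have J: "j div 2 \<in> I" if "j \<in> ?J" for j using that by (auto simp: vdc_index_def)
  have F: "bdd (F i)" if "i \<in> I" for i unfolding F_def by (intro bdd_self_corr f V that)
  have f': "bdd (f' j)" if "j \<in> ?J" for j using F f J[OF that] by (simp add: f'_def bdd_cnj)
  have S': "commuting (S' j N)" if "j \<in> ?J" for j N using S J[OF that] by (simp add: S'_def)
  have rV: "?r j n \<in> V" if "j \<in> ?J" for j n
    unfolding vdc_poly_def by (intro diff_in V J that q)
  define c where "c = (\<Prod>j\<in>?J. \<integral>x. f' j x \<partial>M)"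
  have lim: "L2_null (\<lambda>N x. avg ?J ?r f' S' N x - c)"
    unfolding c_def by (intro conv[unfolded averages_converge_def, rule_format] f' S')
  have bop: "bdd (orbit_prod ?J ?r f' S' N n)" for N n
  proof -
    have "bdd (\<lambda>x. f' j (S' j N (\<alpha> (?r j n) x)))" if "j \<in> ?J" for j
      by (rule bdd_compose[OF orbit_map_measurable]) (use S' rV f' that in auto)
    then have "bdd (\<lambda>x. orbit_prod ?J ?r f' S' N n x)" unfolding orbit_prod_def by (rule bdd_prod)
    then show ?thesis .
  qed
  have bavg: "bdd (avg ?J ?r f' S' N)" for N by (rule bdd_avg) (use rV f' S' in auto)
  have bFS: "bdd (\<lambda>x. F q (S q N x))" for N by (rule bdd_compose[OF commuting_measurable[OF S[OF q]] F[OF q]])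
  have corr: "(\<Sum>n = 1..N. \<integral>x. orbit_prod I p f S N (int n + h) x
        * cnj (orbit_prod I p f S N (int n + h') x) \<partial>M) / N
      = (\<integral>x. F q (S q N x) * avg ?J ?r f' S' N x \<partial>M)" for N
  proof -
    have "(\<integral>x. orbit_prod I p f S N (int n + h) x * cnj (orbit_prod I p f S N (int n + h') x) \<partial>M)
        = (\<integral>x. F q (S q N x) * orbit_prod ?J ?r f' S' N (int n) x \<partial>M)" for n
    proof -
      let ?G = "\<lambda>x. F q (S q N x) * orbit_prod ?J ?r f' S' N (int n) x"
      have "(\<integral>x. orbit_prod I p f S N (int n + h) x * cnj (orbit_prod I p f S N (int n + h') x) \<partial>M)
          = (\<integral>x. ?G (\<alpha> (p q (int n + h)) x) \<partial>M)"
        by (rule Bochner_Integration.integral_cong[OF refl])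
           (unfold F_def f'_def S'_def, rule orbit_prod_correlation[where S = S, OF adm q S])
      also have "\<dots> = (\<integral>x. ?G x \<partial>M)"
        by (rule measure_preserving_integral[OF \<alpha>_mp[OF V[OF q]]])
           (rule bdd_measurable[OF bdd_mult[OF bFS bop]])
      finally show ?thesis .
    qed
    then show ?thesis
      using bdd_integrable[OF bdd_mult[OF bFS bop]]
      by (simp add: avg_def sum_distrib_left)
  qed
  have meanF: "(\<integral>x. F q (S q N x) \<partial>M) = (\<integral>x. F q x \<partial>M)" for N
    by (rule measure_preserving_integral)
       (use S[OF q] bdd_measurable[OF F[OF q]] in \<open>auto simp: commuting_def\<close>)
  obtain B where B: "\<And>x. x \<in> space M \<Longrightarrow> cmod (F q x) \<le> B" using F[OF q] by (metis bddE)
  have "(\<lambda>N. (\<integral>x. F q (S q N x) * avg ?J ?r f' S' N x \<partial>M) - (\<integral>x. F q x \<partial>M) * c) \<longlonglongrightarrow> 0"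
  proof (rule tendsto_norm_zero_cancel, rule tendsto_sandwich[OF _ _ tendsto_const])
    let ?D = "\<lambda>N x. avg ?J ?r f' S' N x - c"
    have bD: "bdd (?D N)" for N by (intro bdd_diff bavg bdd_const)
    have "(\<lambda>N. sqrt (B\<^sup>2 * (\<integral>x. (cmod (?D N x))\<^sup>2 \<partial>M))) \<longlonglongrightarrow> sqrt (B\<^sup>2 * 0)"
      using lim unfolding L2_null_def by (intro tendsto_intros)
    then show "(\<lambda>N. sqrt (B\<^sup>2 * (\<integral>x. (cmod (?D N x))\<^sup>2 \<partial>M))) \<longlonglongrightarrow> 0" by simp
    show "\<forall>\<^sub>F N in sequentially. norm ((\<integral>x. F q (S q N x) * avg ?J ?r f' S' N x \<partial>M) - (\<integral>x. F q x \<partial>M) * c)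
        \<le> sqrt (B\<^sup>2 * (\<integral>x. (cmod (?D N x))\<^sup>2 \<partial>M))"
    proof (intro always_eventually allI)
      fix N
      have "(\<integral>x. F q (S q N x) * avg ?J ?r f' S' N x \<partial>M) - (\<integral>x. F q x \<partial>M) * c
          = (\<integral>x. F q (S q N x) * ?D N x \<partial>M)"
        unfolding meanF[of N, symmetric]
        using bdd_integrable[OF bdd_mult[OF bFS bavg]] bdd_integrable[OF bFS]
        by (simp add: right_diff_distrib)
      then have "(norm ((\<integral>x. F q (S q N x) * avg ?J ?r f' S' N x \<partial>M) - (\<integral>x. F q x \<partial>M) * c))\<^sup>2
          \<le> (\<integral>x. (cmod (F q (S q N x) * ?D N x))\<^sup>2 \<partial>M)"
        using norm_integral_square_le[OF bdd_mult[OF bFS bD]] by simp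
      also have "\<dots> \<le> (\<integral>x. B\<^sup>2 * (cmod (?D N x))\<^sup>2 \<partial>M)"
      proof (rule integral_mono)
        fix x assume "x \<in> space M"
        then have "cmod (F q (S q N x)) \<le> B"
          using B measurable_space[OF commuting_measurable[OF S[OF q]]] by blast
        then show "(cmod (F q (S q N x) * ?D N x))\<^sup>2 \<le> B\<^sup>2 * (cmod (?D N x))\<^sup>2"
          by (simp add: norm_mult power_mult_distrib mult_right_mono power_mono)
      qed (use bdd_integrable_norm_square[OF bdd_mult[OF bFS bD]] bdd_integrable_norm_square[OF bD] in auto)
      also have "\<dots> = B\<^sup>2 * (\<integral>x. (cmod (?D N x))\<^sup>2 \<partial>M)" by simp
      finally show "norm ((\<integral>x. F q (S q N x) * avg ?J ?r f' S' N x \<partial>M) - (\<integral>x. F q x \<partial>M) * c)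
          \<le> sqrt (B\<^sup>2 * (\<integral>x. (cmod (?D N x))\<^sup>2 \<partial>M))"
        by (rule real_le_rsqrt)
    qed
  qed simp
  then have "(\<lambda>N. \<integral>x. F q (S q N x) * avg ?J ?r f' S' N x \<partial>M) \<longlonglongrightarrow> (\<integral>x. F q x \<partial>M) * c"
    by (rule LIM_zero_cancel)
  also have "(\<integral>x. F q x \<partial>M) * c = (\<Prod>i\<in>I. \<integral>x. F i x \<partial>M)
      * (\<Prod>i\<in>{i \<in> I. \<not> poly_deg_le 1 (p i)}. cnj (\<integral>x. f i x \<partial>M))"
    unfolding c_def vdc_index_prod[OF fin] prod.remove[OF fin q]
    by (simp add: f'_def mult.assoc)
  finally show ?thesis unfolding corr F_def .
qed

text \<open>Two translates by the same shift differ by a translate of \<open>p i - p j\<close>, and two translates by \<open>h\<close> and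
  \<open>h'\<close>, the second of a map that is not affine, agree up to a constant for at most one value of
  \<open>h' - h\<close>. Multiples of an \<open>m\<close> exceeding all these values avoid them.\<close>

lemma admissible_vdc:
  assumes adm: "admissible I p" and q: "q \<in> I"
  shows "\<exists>m>0. \<forall>h h'. h \<noteq> h' \<longrightarrow> m dvd h' - h \<longrightarrow>
    admissible (vdc_index q I p) (vdc_poly q h h' p)"
proof -
  have fin: "finite I" and V: "\<And>i n. i \<in> I \<Longrightarrow> p i n \<in> V"
    and deg: "\<And>i. i \<in> I \<Longrightarrow> \<exists>d. poly_deg_le d (p i)"
    and dist: "\<And>i j. i \<in> I \<Longrightarrow> j \<in> I \<Longrightarrow> i \<noteq> j \<Longrightarrow> \<not> poly_deg_le 0 (\<lambda>n. p i n - p j n)"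
    using adm by (auto simp: admissible_def)
  define N where "N = {i \<in> I. \<not> poly_deg_le 1 (p i)}"
  \<comment> \<open>The values of \<open>h' - h\<close> for which two members of the differenced family agree up to a constant.\<close>
  define Bad where "Bad = (\<Union>i\<in>I. \<Union>j\<in>N. {t. poly_deg_le 0 (\<lambda>n. p j (n + t) - p i n)})"
  have "finite {t. poly_deg_le 0 (\<lambda>n. p j (n + t) - p i n)}" if "j \<in> N" for i j
  proof (cases "{t. poly_deg_le 0 (\<lambda>n. p j (n + t) - p i n)} = {}")
    case False
    then obtain s where s: "poly_deg_le 0 (\<lambda>n. p j (n + s) - p i n)" by blast
    have "j \<in> I" using that by (simp add: N_def)
    then obtain d where "poly_deg_le d (p j)" using deg by blast
    then have "{t. poly_deg_le 0 (\<lambda>n. p j (n + t) - p i n)} \<subseteq> {s}"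
      using nonaffine_shift_unique[OF _ _ s] that by (auto simp: N_def)
    then show ?thesis by (rule finite_subset) simp
  qed simp
  then have finBad: "finite Bad" using fin by (auto simp: Bad_def N_def)
  define m where "m = 1 + (\<Sum>t\<in>Bad. \<bar>t\<bar>)"
  have mBad: "\<bar>t\<bar> < m" if "t \<in> Bad" for t
    using member_le_sum[of t Bad "\<lambda>t. \<bar>t\<bar>"] that finBad by (simp add: m_def)
  have mpos: "m > 0" unfolding m_def by (simp add: add_pos_nonneg sum_nonneg)
  have "admissible (vdc_index q I p) (vdc_poly q h h' p)" if hh: "h \<noteq> h'" "m dvd h' - h" for h h'
  proof -
    have notbad: "h' - h \<notin> Bad"
      using dvd_imp_le_int[of "h' - h" m] hh mpos mBad[of "h' - h"] by auto
    have same: "\<not> poly_deg_le 0 (\<lambda>n. p i (n + k) - p j (n + k))" if "i \<in> I" "j \<in> I" "i \<noteq> j" for i j k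
      using dist[OF that] poly_deg_le_shift_iff[of 0 "\<lambda>n. p i n - p j n" k] by simp
    have diff: "\<not> poly_deg_le 0 (\<lambda>n. p j (n + h') - p i (n + h))" if "i \<in> I" "j \<in> N" for i j
    proof -
      have "\<not> poly_deg_le 0 (\<lambda>n. p j (n + (h' - h)) - p i n)"
        using notbad that unfolding Bad_def by blast
      then show ?thesis
        using poly_deg_le_shift_iff[of 0 "\<lambda>n. p j (n + (h' - h)) - p i n" h]
        by (simp add: algebra_simps)
    qed
    have diff': "\<not> poly_deg_le 0 (\<lambda>n. p i (n + h) - p j (n + h'))" if "i \<in> I" "j \<in> N" for i j
      using diff[OF that] poly_deg_le_minus_iff[of 0 "\<lambda>n. p i (n + h)" "\<lambda>n. p j (n + h')"] by simp
    have J: "\<exists>i. j = 2 * i \<and> i \<in> I \<and> i \<noteq> q \<or> j = 2 * i + 1 \<and> i \<in> N" if "j \<in> vdc_index q I p" for j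
      using that by (auto simp: vdc_index_def N_def)
    have NI: "i \<in> I" if "i \<in> N" for i using that by (simp add: N_def)
    show ?thesis
      unfolding admissible_def
    proof (intro conjI ballI allI impI)
      show "finite (vdc_index q I p)" using fin by (simp add: vdc_index_def)
    next
      fix j assume "j \<in> vdc_index q I p"
      from J[OF this] have j: "j div 2 \<in> I" using NI by auto
      obtain d e where d: "poly_deg_le d (p (j div 2))" and e: "poly_deg_le e (p q)"
        using deg j q by blast
      have "poly_deg_le (max d e) (vdc_poly q h h' p j)"
        unfolding vdc_poly_def
        by (intro poly_deg_le_diff poly_deg_le_shift poly_deg_le_mono[OF d] poly_deg_le_mono[OF e]) auto
      then show "\<exists>d. poly_deg_le d (vdc_poly q h h' p j)" by blast
      show "vdc_poly q h h' p j n \<in> V" for n unfolding vdc_poly_def by (intro diff_in V j q)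
    next
      fix j assume "j \<in> vdc_index q I p"
      from J[OF this] show "\<not> poly_deg_le 0 (vdc_poly q h h' p j)"
        using same[OF _ q] diff[OF q] by (auto simp: vdc_poly_def[abs_def])
    next
      fix j k assume "j \<in> vdc_index q I p" "k \<in> vdc_index q I p" "j \<noteq> k"
      from J[OF this(1)] J[OF this(2)] this(3)
      show "\<not> poly_deg_le 0 (\<lambda>n. vdc_poly q h h' p j n - vdc_poly q h h' p k n)"
        using same diff diff' NI by (auto simp: vdc_poly_def)
    qed
  qed
  then show ?thesis using mpos by blast
qed

lemma norm_integral_le_1:
  assumes "bdd_meas M 1 f" shows "cmod (\<integral>x. f x \<partial>M) \<le> 1"
proof -
  have "cmod (\<integral>x. f x \<partial>M) \<le> (\<integral>x. cmod (f x) \<partial>M)" by simp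
  also have "\<dots> \<le> 1"
    by (rule integral_le_const)
       (use bdd_integrable[OF bdd_meas_imp_bdd[OF assms]] assms in \<open>auto simp: bdd_meas_def\<close>)
  finally show ?thesis .
qed

text \<open>The shifts are the multiples of \<open>m\<close>. The limits of the correlations are products of integrals bounded
  by \<open>1\<close>. If the mean zero function belongs to a map that is not affine, its own integral is among
  the factors. Otherwise the self-correlation along the slope is a factor, and it is small on
  average over all pairs of shifts, since the slope is nonzero and hence weakly mixing.\<close>

lemma mean_zero_averages_vanish_step:
  assumes adm: "admissible I p" and q: "q \<in> I" and "m > 0"
    and conv: "\<And>h h'. h \<noteq> h' \<Longrightarrow> m dvd h' - h \<Longrightarrow>
      averages_converge (vdc_index q I p) (vdc_poly q h h' p)"
  shows "mean_zero_averages_vanish I p"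
  unfolding mean_zero_averages_vanish_def
proof (intro allI impI)
  fix f and S :: "nat \<Rightarrow> nat \<Rightarrow> 'a \<Rightarrow> 'a"
  assume f0: "\<forall>i\<in>I. bdd_meas M 1 (f i)" and S0: "\<forall>i\<in>I. \<forall>N. commuting (S i N)"
    and zero: "\<exists>i\<in>I. (\<integral>x. f i x \<partial>M) = 0"
  have f1: "\<And>i. i \<in> I \<Longrightarrow> bdd_meas M 1 (f i)" and S: "\<And>i N. i \<in> I \<Longrightarrow> commuting (S i N)"
    using f0 S0 by auto
  have fin: "finite I" and V: "\<And>i n. i \<in> I \<Longrightarrow> p i n \<in> V"
    and nconst: "\<And>i. i \<in> I \<Longrightarrow> \<not> poly_deg_le 0 (p i)" using adm by (auto simp: admissible_def)
  have f: "bdd (f i)" if "i \<in> I" for i by (rule bdd_meas_imp_bdd[OF f1[OF that]])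
  obtain i0 where i0: "i0 \<in> I" "(\<integral>x. f i0 x \<partial>M) = 0" using zero by blast
  let ?N = "{i \<in> I. \<not> poly_deg_le 1 (p i)}"
  define \<eta> where "\<eta> s = m * int s" for s :: nat
  define \<gamma> where "\<gamma> s t = (\<Prod>i\<in>I. \<integral>x. self_corr (p i) (\<eta> t - \<eta> s) (f i) x \<partial>M)
        * (\<Prod>i\<in>?N. cnj (\<integral>x. f i x \<partial>M))" for s t
  have corr1: "bdd_meas M 1 (self_corr (p i) k (f i))" if "i \<in> I" for i k
  proof -
    have "cmod (self_corr (p i) k (f i) x) \<le> 1" if "x \<in> space M" for x
    proof -
      have "\<alpha> (frag_cmul k (p i 1 - p i 0)) x \<in> space M"
        by (intro \<alpha>_space cmul_in diff_in V \<open>i \<in> I\<close> that)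
      then show ?thesis
        using f1[OF \<open>i \<in> I\<close>] that by (auto simp: self_corr_def bdd_meas_def norm_mult intro: mult_le_one)
    qed
    then show ?thesis
      using bdd_measurable[OF bdd_self_corr[of "f i" "p i" k]] f[OF that] V[OF that]
      by (simp add: bdd_meas_def)
  qed
  have prod1: "cmod (\<Prod>i\<in>A. z i) \<le> 1" if "\<And>i. i \<in> A \<Longrightarrow> cmod (z i) \<le> 1" for A and z :: "nat \<Rightarrow> complex"
    unfolding prod_norm[symmetric] by (rule prod_le_1) (use that in auto)
  have meanN: "cmod (\<Prod>i\<in>?N. cnj (\<integral>x. f i x \<partial>M)) \<le> 1"
    by (rule prod1) (use norm_integral_le_1[OF f1] in auto)
  \<comment> \<open>The limits of the correlations are bounded by numbers that are small on average.\<close>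
  have "\<exists>a. (\<forall>s t. cmod (\<gamma> s t) \<le> a s t) \<and> (\<lambda>H. (\<Sum>s<H. \<Sum>t<H. a s t) / (real H)\<^sup>2) \<longlonglongrightarrow> 0"
  proof (cases "poly_deg_le 1 (p i0)")
    case False
    then have "i0 \<in> ?N" using i0 by simp
    then have "(\<Prod>i\<in>?N. cnj (\<integral>x. f i x \<partial>M)) = 0"
      using fin i0(2) by (intro prod_zero) auto
    then have "\<gamma> s t = 0" for s t by (simp add: \<gamma>_def)
    then show ?thesis by (intro exI[of _ "\<lambda>_ _. 0"]) simp
  next
    case True
    define v where "v = frag_cmul m (p i0 1 - p i0 0)"
    have "p i0 1 - p i0 0 \<noteq> 0"
    proof
      assume "p i0 1 - p i0 0 = 0"
      then have "p i0 n = p i0 0" for n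
        using poly_deg_le_1_affine[OF True, of 0 n] by (metis add_0 add.right_neutral frag_cmul_zero2)
      then show False using nconst[OF i0(1)] unfolding poly_deg_le.simps by blast
    qed
    then have v: "v \<in> V" "v \<noteq> 0" using \<open>m > 0\<close> V[OF i0(1)] by (auto simp: v_def intro: cmul_in diff_in)
    define a where "a s t = cmod (\<integral>x. f i0 ((\<alpha> v ^^ s) x) * cnj (f i0 ((\<alpha> v ^^ t) x)) \<partial>M)" for s t
    have eq: "cmod (\<integral>x. self_corr (p i0) (\<eta> t - \<eta> s) (f i0) x \<partial>M) = a s t" for s t
    proof -
      let ?k = "\<eta> t - \<eta> s"
      have k: "frag_cmul ?k (p i0 1 - p i0 0) = frag_cmul (int t - int s) v"
        by (simp add: v_def \<eta>_def algebra_simps)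
      have "(\<integral>x. f i0 ((\<alpha> v ^^ s) x) * cnj (f i0 ((\<alpha> v ^^ t) x)) \<partial>M)
          = (\<integral>x. self_corr (p i0) ?k (f i0) (\<alpha> (frag_cmul (int s) v) x) \<partial>M)"
      proof (rule Bochner_Integration.integral_cong[OF refl])
        fix x assume x: "x \<in> space M"
        have "\<alpha> (frag_cmul (int t - int s) v) (\<alpha> (frag_cmul (int s) v) x)
            = \<alpha> (frag_cmul (int t - int s) v + frag_cmul (int s) v) x"
          by (rule \<alpha>_add[symmetric]) (use v x in \<open>auto intro: cmul_in\<close>)
        also have "frag_cmul (int t - int s) v + frag_cmul (int s) v = frag_cmul (int t) v"
          by (simp flip: frag_cmul_distrib)
        finally show "f i0 ((\<alpha> v ^^ s) x) * cnj (f i0 ((\<alpha> v ^^ t) x))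
            = self_corr (p i0) ?k (f i0) (\<alpha> (frag_cmul (int s) v) x)"
          using True by (simp add: self_corr_def k \<alpha>_funpow[OF v(1) x])
      qed
      also have "\<dots> = (\<integral>x. self_corr (p i0) ?k (f i0) x \<partial>M)"
        by (rule measure_preserving_integral[OF \<alpha>_mp[OF cmul_in[OF v(1)]]])
           (use corr1[OF i0(1)] in \<open>simp add: bdd_meas_def\<close>)
      finally show ?thesis by (simp add: a_def)
    qed
    have "cmod (\<gamma> s t) \<le> a s t" for s t
    proof -
      let ?z = "\<lambda>i. \<integral>x. self_corr (p i) (\<eta> t - \<eta> s) (f i) x \<partial>M"
      have "\<gamma> s t = ?z i0 * ((\<Prod>i\<in>I - {i0}. ?z i) * (\<Prod>i\<in>?N. cnj (\<integral>x. f i x \<partial>M)))"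
        unfolding \<gamma>_def prod.remove[OF fin i0(1)] by (simp add: mult.assoc)
      also have "cmod \<dots> \<le> cmod (?z i0) * (1 * 1)"
        unfolding norm_mult using meanN prod1[of "I - {i0}" ?z] norm_integral_le_1[OF corr1]
        by (intro mult_left_mono mult_mono) auto
      finally show ?thesis using eq by simp
    qed
    then show ?thesis
      using weakly_mixing_mean_correlation[OF \<alpha>_wm[OF v] f1[OF i0(1)] i0(2)]
      by (intro exI[of _ a]) (simp add: a_def)
  qed
  then obtain a where a: "\<And>s t. cmod (\<gamma> s t) \<le> a s t"
    and a0: "(\<lambda>H. (\<Sum>s<H. \<Sum>t<H. a s t) / (real H)\<^sup>2) \<longlonglongrightarrow> 0" by blast
  have a_nonneg: "0 \<le> a s t" for s t using a[of s t] norm_ge_zero order_trans by blast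
  have op1: "bdd_meas M 1 (orbit_prod I p f S N n)" for N n
  proof -
    have "(\<lambda>x. f i (S i N (\<alpha> (p i n) x))) \<in> borel_measurable M" if "i \<in> I" for i
      by (rule measurable_compose[OF orbit_map_measurable[OF S V]])
         (use that f1[OF that] in \<open>auto simp: bdd_meas_def\<close>)
    moreover have "cmod (f i (S i N (\<alpha> (p i n) x))) \<le> 1" if "i \<in> I" "x \<in> space M" for i x
      using measurable_space[OF orbit_map_measurable[OF S V] that(2)] that f1[OF that(1)]
      by (auto simp: bdd_meas_def)
    ultimately show ?thesis
      unfolding bdd_meas_def orbit_prod_def[abs_def]
      by (auto intro!: borel_measurable_prod prod1)
  qed
  have "(\<lambda>N. \<integral>x. (cmod ((\<Sum>n = 1..N. orbit_prod I p f S N (int n) x) / N))\<^sup>2 \<partial>M) \<longlonglongrightarrow> 0"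
  proof (rule van_der_corput[OF op1])
    fix e :: real assume "e > 0"
    have "\<forall>\<^sub>F H in sequentially. (\<Sum>s<H. \<Sum>t<H. a s t) / (real H)\<^sup>2 < e / 4"
      by (rule order_tendstoD(2)[OF a0]) (use \<open>e > 0\<close> in simp)
    moreover have "\<forall>\<^sub>F H in sequentially. real H \<ge> 4 / e"
      using filterlim_real_sequentially by (simp add: filterlim_at_top)
    moreover have "\<forall>\<^sub>F H in sequentially. H > (0::nat)" by (rule eventually_gt_at_top)
    ultimately have "\<forall>\<^sub>F H in sequentially. H > 0 \<and> real H \<ge> 4 / e \<and> (\<Sum>s<H. \<Sum>t<H. a s t) / (real H)\<^sup>2 < e / 4"
      by eventually_elim auto
    from eventually_happens'[OF sequentially_bot this] obtain H
      where H: "H > 0" "real H \<ge> 4 / e" "(\<Sum>s<H. \<Sum>t<H. a s t) / (real H)\<^sup>2 < e / 4" by blast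
    \<comment> \<open>The diagonal pairs contribute at most \<open>H \<le> e/4 * H\<^sup>2\<close>; the slack \<open>e/4\<close> lets the correlations
      off the diagonal come close to their limits.\<close>
    define g where "g s t = (if s = t then 1 else 0) + (a s t + e / 4)" for s t :: nat
    have "\<forall>\<^sub>F N in sequentially.
        cmod ((\<Sum>n = 1..N. \<integral>x. orbit_prod I p f S N (int n + \<eta> s) x
            * cnj (orbit_prod I p f S N (int n + \<eta> t) x) \<partial>M) / N) \<le> g s t" for s t
    proof (cases "s = t")
      case True
      have le1: "cmod (\<integral>x. orbit_prod I p f S N a x * cnj (orbit_prod I p f S N b x) \<partial>M) \<le> 1" for N a b
        by (rule norm_integral_le_1)
           (use op1 in \<open>auto simp: bdd_meas_def norm_mult intro!: mult_le_one borel_measurable_times borel_measurable_cnj\<close>)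
      have "cmod ((\<Sum>n = 1..N. \<integral>x. orbit_prod I p f S N (int n + \<eta> s) x
            * cnj (orbit_prod I p f S N (int n + \<eta> t) x) \<partial>M) / N) \<le> 1" for N
      proof -
        have "cmod (\<Sum>n = 1..N. \<integral>x. orbit_prod I p f S N (int n + \<eta> s) x
            * cnj (orbit_prod I p f S N (int n + \<eta> t) x) \<partial>M) \<le> (\<Sum>n = 1..N. 1)"
          by (rule sum_norm_le) (rule le1)
        then show ?thesis by (simp add: norm_divide divide_simps)
      qed
      moreover have "1 \<le> g s t" using True a_nonneg \<open>e > 0\<close> by (simp add: g_def)
      ultimately show ?thesis by (intro always_eventually allI) (rule order_trans)
    next
      case False
      have "averages_converge (vdc_index q I p) (vdc_poly q (\<eta> s) (\<eta> t) p)"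
      proof (rule conv)
        show "\<eta> s \<noteq> \<eta> t" using False \<open>m > 0\<close> by (simp add: \<eta>_def)
        show "m dvd \<eta> t - \<eta> s" by (simp add: \<eta>_def)
      qed
      from correlations_converge[OF adm q f S this]
      have lim: "(\<lambda>N. cmod ((\<Sum>n = 1..N. \<integral>x. orbit_prod I p f S N (int n + \<eta> s) x
            * cnj (orbit_prod I p f S N (int n + \<eta> t) x) \<partial>M) / N)) \<longlonglongrightarrow> cmod (\<gamma> s t)"
        unfolding \<gamma>_def by (rule tendsto_norm)
      have "cmod (\<gamma> s t) < g s t" using False a[of s t] \<open>e > 0\<close> by (simp add: g_def)
      from order_tendstoD(2)[OF lim this] show ?thesis by eventually_elim simp
    qed
    moreover have "(\<Sum>s<H. \<Sum>t<H. g s t) \<le> e * (real H)\<^sup>2"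
    proof -
      have "(\<Sum>s<H. \<Sum>t<H. g s t) = real H + (\<Sum>s<H. \<Sum>t<H. a s t) + e / 4 * (real H)\<^sup>2"
        by (simp add: g_def sum.distrib power2_eq_square)
      moreover have "real H \<le> e / 4 * (real H)\<^sup>2"
      proof -
        have "1 \<le> e / 4 * real H" using H(2) \<open>e > 0\<close> by (simp add: field_simps)
        from mult_right_mono[OF this, of "real H"] show ?thesis by (simp add: power2_eq_square)
      qed
      moreover have "(\<Sum>s<H. \<Sum>t<H. a s t) \<le> e / 4 * (real H)\<^sup>2"
        using H(1,3) by (simp add: divide_simps mult.commute)
      ultimately show ?thesis using \<open>e > 0\<close> by (simp add: field_simps)
    qed
    ultimately show "\<exists>H \<eta> g. 0 < H \<and>
      (\<forall>s<H. \<forall>t<H. \<forall>\<^sub>F N in sequentially.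
        cmod ((\<Sum>n = 1..N. \<integral>x. orbit_prod I p f S N (int n + \<eta> s) x
          * cnj (orbit_prod I p f S N (int n + \<eta> t) x) \<partial>M) / N) \<le> g s t)
      \<and> (\<Sum>s<H. \<Sum>t<H. g s t) \<le> e * (real H)\<^sup>2"
      using H(1) by blast
  qed
  then show "L2_null (avg I p f S)" unfolding L2_null_def avg_def .
qed

end

section \<open>Induction on the radii of a cover\<close>

context mixing_action begin

text \<open>A pair \<open>(d, r)\<close> is the ball of all \<open>p\<close> such that \<open>p - r\<close> has degree at most \<open>d\<close>. Asking that \<open>r\<close> has degree at
  most \<open>d + 1\<close> bounds the degree of every member of the ball by \<open>d + 1\<close>, so that translating a member does not
  move it out of the ball.\<close>

definition covers :: "(nat \<times> (int \<Rightarrow> 'b \<Rightarrow>\<^sub>0 int)) multiset \<Rightarrow> nat set \<Rightarrow> (nat \<Rightarrow> int \<Rightarrow> 'b \<Rightarrow>\<^sub>0 int) \<Rightarrow> bool" where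
  "covers W I p \<longleftrightarrow> (\<forall>(d, r)\<in>#W. poly_deg_le (Suc d) r)
    \<and> (\<forall>i\<in>I. \<exists>(d, r)\<in>#W. poly_deg_le d (\<lambda>n. p i n - r n))"

text \<open>Let \<open>d0\<close> be the least radius. A ball of radius \<open>d0\<close> without members can be dropped. Otherwise
  difference along a member \<open>q\<close> of it. The other balls are translated by \<open>- p q (n + h)\<close>, which
  is compatible with their radii because \<open>d0\<close> is the least one. The members of the ball of \<open>q\<close> turn into maps of
  degree at most \<open>d0\<close>, each of which is the centre of a new ball of radius \<open>d0 - 1\<close>; for \<open>d0 = 0\<close> they would be
  constant, so there are none.\<close>

lemma averages_converge_if_covered:
  "admissible I p \<Longrightarrow> covers W I p \<Longrightarrow> averages_converge I p"
proof (induction "image_mset fst W" arbitrary: W I p rule: wf_induct_rule[OF wf_mult[OF wf[where 'a = nat]]])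
  case (1 W I p)
  have adm: "admissible I p" and cov: "covers W I p" by fact+
  have fin: "finite I" and V: "\<And>i n. i \<in> I \<Longrightarrow> p i n \<in> V"
    and nconst: "\<And>i. i \<in> I \<Longrightarrow> \<not> poly_deg_le 0 (p i)" using adm by (auto simp: admissible_def)
  show ?case
  proof (cases "I = {}")
    case True
    then show ?thesis
      by (intro averages_converge_if_mean_zero_vanish) (auto simp: mean_zero_averages_vanish_def)
  next
    case False
    then have "W \<noteq> {#}" using cov by (auto simp: covers_def)
    then have ne: "fst ` set_mset W \<noteq> {}" by simp
    define d0 where d0: "d0 = Min (fst ` set_mset W)"
    have "d0 \<in> fst ` set_mset W" unfolding d0 by (rule Min_in) (use ne in auto)
    then obtain r0 where w0: "(d0, r0) \<in># W" by auto
    have min: "d0 \<le> d" if "(d, r) \<in># W" for d r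
      unfolding d0 by (rule Min_le) (use that in force)+
    define W0 where "W0 = W - {#(d0, r0)#}"
    have W: "W = add_mset (d0, r0) W0" using w0 by (simp add: W0_def)
    show ?thesis
    proof (cases "\<exists>q\<in>I. poly_deg_le d0 (\<lambda>n. p q n - r0 n)")
      case False
      have "(image_mset fst W0, image_mset fst W) \<in> Multiset.mult {(x, y). x < y}"
        using one_step_implies_mult[of "{#d0#}" "{#}" "{(x, y). x < y}" "image_mset fst W0"] by (simp add: W)
      moreover have "covers W0 I p" using cov False by (auto simp: covers_def W)
      ultimately show ?thesis using 1(1) adm by blast
    next
      case True
      then obtain q where q: "q \<in> I" and qr0: "poly_deg_le d0 (\<lambda>n. p q n - r0 n)" by blast
      have deg_r: "poly_deg_le (Suc d) r" if "(d, r) \<in># W" for d r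
        using cov that by (auto simp: covers_def)
      have deg_q: "poly_deg_le (Suc d0) (p q)"
        using poly_deg_le_add[OF poly_deg_le_Suc[OF qr0] deg_r[OF w0]] by simp
      obtain m where "m > 0" and m: "\<And>h h'. h \<noteq> h' \<Longrightarrow> m dvd h' - h \<Longrightarrow>
          admissible (vdc_index q I p) (vdc_poly q h h' p)"
        using admissible_vdc[OF adm q] by blast
      have "averages_converge (vdc_index q I p) (vdc_poly q h h' p)" if hh: "h \<noteq> h'" "m dvd h' - h" for h h'
      proof -
        let ?J = "vdc_index q I p" and ?r = "vdc_poly q h h' p"
        have admJ: "admissible ?J ?r" by (rule m[OF hh])
        then have finJ: "finite ?J" by (simp add: admissible_def)
        \<comment> \<open>The new balls that replace the one containing \<open>q\<close>.\<close>
        define K where "K = (if d0 = 0 then {#}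
          else mset_set ((\<lambda>j. (d0 - 1, ?r j)) ` {j \<in> ?J. poly_deg_le d0 (?r j)}))"
        define W' where "W' = image_mset (\<lambda>(d, r). (d, \<lambda>n. r n - p q (n + h))) W0 + K"
        have "image_mset fst W' = image_mset fst W0 + image_mset fst K"
          by (simp add: W'_def multiset.map_comp comp_def split_def)
        moreover have "(image_mset fst W0 + image_mset fst K, image_mset fst W0 + {#d0#})
            \<in> Multiset.mult {(x, y). x < y}"
          by (rule one_step_implies_mult) (use finJ in \<open>auto simp: K_def split: if_splits\<close>)
        ultimately have smaller: "(image_mset fst W', image_mset fst W) \<in> Multiset.mult {(x, y). x < y}"
          by (simp add: W)
        have "covers W' ?J ?r"
          unfolding covers_def
        proof (intro conjI ballI)
          fix w assume "w \<in># W'"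
          then consider d r where "w = (d, \<lambda>n. r n - p q (n + h))" "(d, r) \<in># W0"
            | j where "d0 \<noteq> 0" "w = (d0 - 1, ?r j)" "poly_deg_le d0 (?r j)"
            using finJ by (auto simp: W'_def K_def split: if_splits)
          then show "case w of (d, r) \<Rightarrow> poly_deg_le (Suc d) r"
          proof cases
            case 1
            then have "(d, r) \<in># W" by (simp add: W)
            then have "poly_deg_le (Suc d) (\<lambda>n. r n - p q (n + h))"
              by (intro poly_deg_le_diff deg_r poly_deg_le_shift poly_deg_le_mono[OF deg_q])
                 (use min in auto)
            then show ?thesis using 1 by simp
          qed simp
        next
          fix j assume j: "j \<in> ?J"
          define k where "k = (if even j then h else h')"
          define i where "i = j div 2"
          have i: "i \<in> I" using j by (auto simp: vdc_index_def i_def)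
          have rj: "?r j n = p i (n + k) - p q (n + h)" for n by (simp add: vdc_poly_def i_def k_def)
          obtain d r where dr: "(d, r) \<in># W" and pr: "poly_deg_le d (\<lambda>n. p i n - r n)"
            using cov i by (auto simp: covers_def)
          have "poly_deg_le (Suc d) (p i)"
            using poly_deg_le_add[OF poly_deg_le_Suc[OF pr] deg_r[OF dr]] by simp
          from poly_deg_le_Suc_diff_shifts[OF this, of k 0]
          have pik: "poly_deg_le d (\<lambda>n. p i (n + k) - p i n)" by simp
          from poly_deg_le_add[OF this pr]
          have pir: "poly_deg_le d (\<lambda>n. p i (n + k) - r n)" by simp
          show "\<exists>w\<in>#W'. case w of (d, r) \<Rightarrow> poly_deg_le d (\<lambda>n. ?r j n - r n)"
          proof (cases "(d, r) \<in># W0")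
            case True
            then have mem: "(d, \<lambda>n. r n - p q (n + h)) \<in># W'"
              by (auto simp: W'_def intro!: image_eqI[where x = "(d, r)"])
            have "poly_deg_le d (\<lambda>n. ?r j n - (r n - p q (n + h)))"
              using pir by (simp add: rj)
            then show ?thesis by (intro bexI[OF _ mem]) (unfold prod.case)
          next
            case False
            then have [simp]: "d = d0" "r = r0" using dr by (auto simp: W)
            have "poly_deg_le d0 (\<lambda>n. p q (n + h) - p q n)"
              using poly_deg_le_Suc_diff_shifts[OF deg_q, of h 0] by simp
            from poly_deg_le_diff[OF pir, of "\<lambda>n. p q (n + h) - r0 n"] poly_deg_le_add[OF this qr0]
            have rj0: "poly_deg_le d0 (?r j)" by (simp add: rj[abs_def])
            have "\<not> poly_deg_le 0 (?r j)" using admJ j by (simp add: admissible_def)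
            then have "d0 \<noteq> 0" using rj0 by metis
            then have mem: "(d0 - 1, ?r j) \<in># W'" using rj0 j finJ by (auto simp: W'_def K_def)
            then show ?thesis by (intro bexI[OF _ mem]) (simp add: poly_deg_le_const)
          qed
        qed
        then show ?thesis using 1(1)[OF smaller admJ] by blast
      qed
      then have "mean_zero_averages_vanish I p"
        by (rule mean_zero_averages_vanish_step[OF adm q \<open>m > 0\<close>])
      then show ?thesis using averages_converge_if_mean_zero_vanish fin V by blast
    qed
  qed
qed

text \<open>Every family of maps of bounded degree is covered by the balls about its own members.\<close>

lemma averages_converge_if_admissible:
  assumes adm: "admissible I p"
  shows "averages_converge I p"
proof -
  obtain D where D: "\<And>i. i \<in> I \<Longrightarrow> poly_deg_le (D i) (p i)" using adm by (metis admissible_def)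
  have "covers (mset_set ((\<lambda>i. (D i, p i)) ` I)) I p"
    using adm D by (auto simp: covers_def admissible_def poly_deg_le_const intro: poly_deg_le_Suc intro!: bexI)
  then show ?thesis by (rule averages_converge_if_covered[OF adm])
qed

end

section \<open>Words in groups of transformations\<close>

lemma (in group) power_word_in_subgroup:
  assumes "subgroup K G" and "\<And>j. j \<in> {1..k} \<Longrightarrow> x j \<in> K"
  shows "power_word G k x a \<in> K"
proof -
  have "foldr (\<lambda>j y. (x j [^] a j) \<otimes> y) js \<one> \<in> K" if "set js \<subseteq> {1..k}" for js
    using that
  proof (induction js)
    case Nil
    show ?case by (simp add: subgroup.one_closed[OF assms(1)])
  next
    case (Cons j js)
    then show ?case
      by (simp add: subgroup.m_closed[OF assms(1)] subgroup_int_pow_closed[OF assms(1)] assms(2))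
  qed
  then show ?thesis unfolding power_word_def by (metis atLeastLessThanSuc_atLeastAtMost order_refl set_upt)
qed

lemma (in group_hom) hom_power_word:
  assumes "\<And>j. j \<in> {1..k} \<Longrightarrow> x j \<in> carrier G"
  shows "h (power_word G k x a) = power_word H k (\<lambda>j. h (x j)) a"
proof -
  have "foldr (\<lambda>j y. (x j [^] a j) \<otimes> y) js \<one> \<in> carrier G
      \<and> h (foldr (\<lambda>j y. (x j [^] a j) \<otimes> y) js \<one>)
        = foldr (\<lambda>j y. (h (x j) [^]\<^bsub>H\<^esub> a j) \<otimes>\<^bsub>H\<^esub> y) js \<one>\<^bsub>H\<^esub>" if "set js \<subseteq> {1..k}" for js
    using that by (induction js) (auto simp: assms hom_int_pow)
  then show ?thesis unfolding power_word_def by (metis atLeastLessThanSuc_atLeastAtMost order_refl set_upt)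
qed

lemma power_word_free_Abelian_group:
  assumes "\<And>j. j \<in> {1..k} \<Longrightarrow> Poly_Mapping.keys (y j) \<subseteq> S"
  shows "power_word (free_Abelian_group S) k y a = (\<Sum>j = 1..k. frag_cmul (a j) (y j))"
proof -
  have gen: "foldr (\<lambda>j z. (y j [^]\<^bsub>free_Abelian_group S\<^esub> a j) \<otimes>\<^bsub>free_Abelian_group S\<^esub> z) js \<one>\<^bsub>free_Abelian_group S\<^esub>
      = (\<Sum>j\<leftarrow>js. frag_cmul (a j) (y j))" if "set js \<subseteq> {1..k}" for js
    using that by (induction js) (auto simp: assms)
  have "power_word (free_Abelian_group S) k y a = (\<Sum>j\<leftarrow>[1..<Suc k]. frag_cmul (a j) (y j))"
    unfolding power_word_def by (rule gen) auto
  then show ?thesis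
    by (simp add: sum_set_upt_conv_sum_list_nat[symmetric] atLeastLessThanSuc_atLeastAtMost del: upt_Suc)
qed

lemma (in group) subgroup_commuting_with:
  assumes "b \<in> carrier G"
  shows "subgroup {a \<in> carrier G. a \<otimes> b = b \<otimes> a} G"
proof (rule subgroupI)
  fix a assume "a \<in> {a \<in> carrier G. a \<otimes> b = b \<otimes> a}"
  then have a: "a \<in> carrier G" "a \<otimes> b = b \<otimes> a" by auto
  have "inv a \<otimes> (a \<otimes> b) \<otimes> inv a = inv a \<otimes> (b \<otimes> a) \<otimes> inv a" using a(2) by simp
  moreover have "inv a \<otimes> (a \<otimes> b) = b" using a(1) assms by (simp add: m_assoc[symmetric])
  moreover have "inv a \<otimes> (b \<otimes> a) \<otimes> inv a = inv a \<otimes> b" using a(1) assms by (simp add: m_assoc)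
  ultimately have "b \<otimes> inv a = inv a \<otimes> b" by simp
  then show "inv a \<in> {a \<in> carrier G. a \<otimes> b = b \<otimes> a}" using a(1) by simp
next
  fix a c assume "a \<in> {a \<in> carrier G. a \<otimes> b = b \<otimes> a}" "c \<in> {a \<in> carrier G. a \<otimes> b = b \<otimes> a}"
  then show "a \<otimes> c \<in> {a \<in> carrier G. a \<otimes> b = b \<otimes> a}" using assms by (simp add: m_assoc) (simp add: m_assoc[symmetric])
qed (use assms in auto)

lemma measure_preserving_map_cong:
  assumes "\<And>x. x \<in> space M \<Longrightarrow> S x = T x"
  shows "measure_preserving_map M S \<longleftrightarrow> measure_preserving_map M T"
  unfolding measure_preserving_map_def
  using measurable_cong[of M S T M] distr_cong[of M M M M S T] assms by auto

lemma measure_preserving_map_compose: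
  assumes "measure_preserving_map M S" and "measure_preserving_map M T"
  shows "measure_preserving_map M (compose (space M) S T)"
proof -
  have "measure_preserving_map M (S \<circ> T)"
    using assms distr_distr[of S M M T M] unfolding measure_preserving_map_def
    by (auto intro: measurable_comp)
  then show ?thesis
    by (subst measure_preserving_map_cong[of M _ "S \<circ> T"]) (auto simp: compose_def)
qed

lemma BijGroup_mult: "S \<in> carrier (BijGroup A) \<Longrightarrow> T \<in> carrier (BijGroup A) \<Longrightarrow>
  S \<otimes>\<^bsub>BijGroup A\<^esub> T = compose A S T"
  by (simp add: BijGroup_def)

lemma subgroup_invertible_measure_preserving:
  "subgroup {T. invertible_measure_preserving M T} (BijGroup (space M))"
proof -
  interpret B: group "BijGroup (space M)" by (rule group_BijGroup)
  show ?thesis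
  proof (rule B.subgroupI)
    have "measure_preserving_map M (\<lambda>x. x)" by (simp add: measure_preserving_map_def distr_id2)
    then have "measure_preserving_map M \<one>\<^bsub>BijGroup (space M)\<^esub>"
      by (subst measure_preserving_map_cong[of M _ "\<lambda>x. x"]) (auto simp: BijGroup_def)
    then have "invertible_measure_preserving M \<one>\<^bsub>BijGroup (space M)\<^esub>"
      by (simp add: invertible_measure_preserving_def)
    then show "{T. invertible_measure_preserving M T} \<noteq> {}" by blast
  next
    fix S T assume "S \<in> {T. invertible_measure_preserving M T}" "T \<in> {T. invertible_measure_preserving M T}"
    then show "S \<otimes>\<^bsub>BijGroup (space M)\<^esub> T \<in> {T. invertible_measure_preserving M T}"
      by (simp add: invertible_measure_preserving_def B.inv_mult_group)
         (simp add: BijGroup_mult measure_preserving_map_compose)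
  qed (auto simp: invertible_measure_preserving_def)
qed

lemma poly_deg_le_polynomial_word:
  fixes p :: "nat \<Rightarrow> real poly"
  assumes "\<And>j. j \<in> {1..k} \<Longrightarrow> integer_valued (p j)"
  shows "\<exists>d. poly_deg_le d (\<lambda>n. \<Sum>j = 1..k. frag_cmul \<lfloor>poly (p j) (of_int n)\<rfloor> (y j))"
proof -
  define D where "D = (\<Sum>j = 1..k. degree (p j))"
  have "poly_deg_le D (\<lambda>n::int. \<lfloor>poly (p j) (of_int n)\<rfloor>)" if j: "j \<in> {1..k}" for j
  proof -
    have "degree (p j) \<le> D" unfolding D_def by (rule member_le_sum) (use j in auto)
    then have "poly_deg_le D (\<lambda>n::int. poly (p j) (of_int n))" by (rule poly_deg_le_poly)
    also have "(\<lambda>n::int. poly (p j) (of_int n)) = (\<lambda>n::int. of_int \<lfloor>poly (p j) (of_int n)\<rfloor>)"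
      using assms[OF j] by (simp add: integer_valued_def fun_eq_iff)
    finally have "poly_deg_le D (\<lambda>n::int. real_of_int \<lfloor>poly (p j) (of_int n)\<rfloor>)" .
    then show ?thesis by (simp only: poly_deg_le_of_int_iff)
  qed
  then have "poly_deg_le D (\<lambda>n. \<Sum>j = 1..k. frag_cmul \<lfloor>poly (p j) (of_int n)\<rfloor> (y j))"
    by (intro poly_deg_le_sum poly_deg_le_frag_cmul)
  then show ?thesis by blast
qed

section \<open>Polynomial averages for totally weak mixing actions\<close>

theorem theorem2p8:
  fixes M :: "'a measure"
    and G :: "('g, 'm) monoid_scheme"
    and act :: "'g \<Rightarrow> 'a \<Rightarrow> 'a"
    and T :: "nat \<Rightarrow> 'g"
    and hatT :: "nat \<Rightarrow> 'a \<Rightarrow> 'a"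
    and P :: "nat \<Rightarrow> nat \<Rightarrow> real poly"
    and Q :: "nat \<Rightarrow> nat \<Rightarrow> int \<Rightarrow> int"
    and f :: "nat \<Rightarrow> 'a \<Rightarrow> complex"
    and k l :: nat
  assumes "prob_space M"
    and "separable_measure M"
    and "fg_free_abelian G"
    and "measure_preserving_action G M act"
    and "totally_weak_mixing G M act"
    and "\<And>j. j \<in> {1..k} \<Longrightarrow> T j \<in> carrier G \<and> T j \<noteq> \<one>\<^bsub>G\<^esub>"
    and "\<And>j. j \<in> {1..k} \<Longrightarrow> invertible_measure_preserving M (hatT j)"
    and "\<And>i j x. \<lbrakk>i \<in> {1..k}; j \<in> {1..k}; x \<in> space M\<rbrakk>
           \<Longrightarrow> hatT i (hatT j x) = hatT j (hatT i x)"
    and "\<And>i j x. \<lbrakk>i \<in> {1..k}; j \<in> {1..k}; x \<in> space M\<rbrakk>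
           \<Longrightarrow> hatT i (act (T j) x) = act (T j) (hatT i x)"
    and "\<And>i j. \<lbrakk>i \<in> {1..l}; j \<in> {1..k}\<rbrakk> \<Longrightarrow> integer_valued (P i j)"
    and "\<And>i. i \<in> {1..l} \<Longrightarrow> \<not> (\<lambda>n. poly_word G k T (P i) n) constant_on UNIV"
    and "\<And>i j. \<lbrakk>i \<in> {1..l}; j \<in> {1..l}; i \<noteq> j\<rbrakk> \<Longrightarrow>
           \<not> (\<lambda>n. poly_word G k T (P i) n \<otimes>\<^bsub>G\<^esub> inv\<^bsub>G\<^esub> (poly_word G k T (P j) n))
             constant_on UNIV"
    and "\<And>i. i \<in> {1..l} \<Longrightarrow> f i \<in> borel_measurable M \<and> bounded (f i ` space M)"
  shows "tendsto_L2 M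
           (\<lambda>N x. (1 / of_nat N) * (\<Sum>n = 1..N. \<Prod>i = 1..l.
              f i ((act (poly_word G k T (P i) (int n))
                     \<otimes>\<^bsub>BijGroup (space M)\<^esub>
                     power_word (BijGroup (space M)) k hatT (\<lambda>j. Q i j (int N))) x)))
           (\<lambda>x. \<Prod>i = 1..l. \<integral>y. f i y \<partial>M)"
proof -
  let ?B = "BijGroup (space M)"
  interpret prob_space M by fact
  have action: "group_action G (space M) act"
    and act_mp: "\<And>g. g \<in> carrier G \<Longrightarrow> measure_preserving_map M (act g)"
    using assms(4) by (auto simp: measure_preserving_action_def)
  interpret A: group_action G "space M" act by (rule action)
  interpret AH: group_hom G ?B act by (rule A.group_hom)
  have T: "T j \<in> carrier G" if "j \<in> {1..k}" for j using assms(6) that by blast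
  obtain Z :: "nat set" and \<psi> where \<psi>: "\<psi> \<in> iso G (free_Abelian_group Z)"
    using assms(3) by (auto simp: fg_free_abelian_def is_iso_def)
  then have \<psi>_hom: "\<psi> \<in> hom G (free_Abelian_group Z)" and inj: "inj_on \<psi> (carrier G)"
    by (auto simp: iso_def bij_betw_def)
  interpret \<psi>: group_hom G "free_Abelian_group Z" \<psi>
    by (intro group_hom.intro group_hom_axioms.intro AH.G.is_group group_free_Abelian_group \<psi>_hom)
  have \<psi>_mult: "\<psi> (g \<otimes>\<^bsub>G\<^esub> h) = \<psi> g + \<psi> h" if "g \<in> carrier G" "h \<in> carrier G" for g h
    using \<psi>.hom_mult that by simp
  have \<psi>_inv: "\<psi> (inv\<^bsub>G\<^esub> g) = - \<psi> g" if "g \<in> carrier G" for g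
    using \<psi>.hom_inv[OF that] \<psi>.hom_closed[OF that] by simp
  define w where "w a = power_word G k T a" for a
  have w: "w a \<in> carrier G" for a
    unfolding w_def by (rule AH.G.power_word_in_subgroup[OF AH.G.subgroup_self T])
  have \<psi>w: "\<psi> (w a) = (\<Sum>j = 1..k. frag_cmul (a j) (\<psi> (T j)))" for a
  proof -
    have "\<psi> (w a) = power_word (free_Abelian_group Z) k (\<lambda>j. \<psi> (T j)) a"
      unfolding w_def by (rule \<psi>.hom_power_word[OF T])
    also have "\<dots> = (\<Sum>j = 1..k. frag_cmul (a j) (\<psi> (T j)))"
      by (rule power_word_free_Abelian_group) (use \<psi>.hom_closed[OF T] in simp)
    finally show ?thesis .
  qed
  \<comment> \<open>The subgroup generated by the \<open>T j\<close>, written additively, and its action.\<close>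
  define V where "V = range (\<lambda>a. \<psi> (w a))"
  define \<alpha> where "\<alpha> v = act (inv_into (carrier G) \<psi> v)" for v
  have \<alpha>: "\<alpha> (\<psi> g) = act g" if "g \<in> carrier G" for g
    unfolding \<alpha>_def using inv_into_f_f[OF inj that] by simp
  have hats: "power_word ?B k hatT b \<in> {S. invertible_measure_preserving M S}" for b
    by (rule group.power_word_in_subgroup[OF group_BijGroup subgroup_invertible_measure_preserving])
       (use assms(7) in simp)
  have hats_B: "power_word ?B k hatT b \<in> carrier ?B" for b
    using hats[of b] by (simp add: invertible_measure_preserving_def)
  have hatT_B: "hatT j \<in> carrier ?B" if "j \<in> {1..k}" for j
    using assms(7)[OF that] by (simp add: invertible_measure_preserving_def)
  \<comment> \<open>Words in the \<open>hatT j\<close> commute with each \<open>T j\<close>, hence with all words in the \<open>T j\<close>.\<close>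
  have comm1: "power_word ?B k hatT b \<otimes>\<^bsub>?B\<^esub> act (T j) = act (T j) \<otimes>\<^bsub>?B\<^esub> power_word ?B k hatT b"
    if j: "j \<in> {1..k}" for j b
  proof -
    have "power_word ?B k hatT b \<in> {a \<in> carrier ?B. a \<otimes>\<^bsub>?B\<^esub> act (T j) = act (T j) \<otimes>\<^bsub>?B\<^esub> a}"
    proof (rule AH.H.power_word_in_subgroup[OF AH.H.subgroup_commuting_with])
      fix i assume i: "i \<in> {1..k}"
      have "compose (space M) (hatT i) (act (T j)) = compose (space M) (act (T j)) (hatT i)"
        unfolding compose_def by (rule restrict_ext) (use assms(9) i j in auto)
      then show "hatT i \<in> {a \<in> carrier ?B. a \<otimes>\<^bsub>?B\<^esub> act (T j) = act (T j) \<otimes>\<^bsub>?B\<^esub> a}"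
        using hatT_B[OF i] AH.hom_closed[OF T[OF j]] by (simp add: BijGroup_mult)
    qed (use T[OF j] in auto)
    then show ?thesis by simp
  qed
  have comm2: "act (w a) \<otimes>\<^bsub>?B\<^esub> power_word ?B k hatT b = power_word ?B k hatT b \<otimes>\<^bsub>?B\<^esub> act (w a)" for a b
  proof -
    have "power_word ?B k (\<lambda>j. act (T j)) a \<in>
        {c \<in> carrier ?B. c \<otimes>\<^bsub>?B\<^esub> power_word ?B k hatT b = power_word ?B k hatT b \<otimes>\<^bsub>?B\<^esub> c}"
      by (rule AH.H.power_word_in_subgroup[OF AH.H.subgroup_commuting_with])
         (use hats_B comm1 T in auto)
    moreover have "act (w a) = power_word ?B k (\<lambda>j. act (T j)) a"
      unfolding w_def by (rule AH.hom_power_word[OF T])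
    ultimately show ?thesis by simp
  qed
  have mult_apply: "(act (w a) \<otimes>\<^bsub>?B\<^esub> power_word ?B k hatT b) x = power_word ?B k hatT b (act (w a) x)"
    if "x \<in> space M" for a b x
    unfolding comm2 using that AH.hom_closed[OF w] hats_B by (simp add: BijGroup_mult compose_eq)
  have mult_apply': "(act (w a) \<otimes>\<^bsub>?B\<^esub> power_word ?B k hatT b) x = act (w a) (power_word ?B k hatT b x)"
    if "x \<in> space M" for a b x
    using that AH.hom_closed[OF w] hats_B by (simp add: BijGroup_mult compose_eq)
  interpret mixing_action M V \<alpha>
  proof
    have "\<psi> (w (\<lambda>_. 0)) = 0" by (simp add: \<psi>w)
    then show "0 \<in> V" unfolding V_def by (metis rangeI)
    show "\<alpha> 0 x = x" if "x \<in> space M" for x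
      using \<alpha>[OF AH.G.one_closed] \<psi>.hom_one A.id_eq_one that by (metis one_free_Abelian_group restrict_apply')
    show "u - v \<in> V" if uv: "u \<in> V" "v \<in> V" for u v
    proof -
      obtain a b where "u = \<psi> (w a)" "v = \<psi> (w b)" using uv by (auto simp: V_def)
      then have "u - v = \<psi> (w (\<lambda>j. a j - b j))" by (simp add: \<psi>w frag_cmul_diff_distrib sum_subtractf)
      then show ?thesis by (simp add: V_def)
    qed
    show "measure_preserving_map M (\<alpha> v)" if "v \<in> V" for v
      using that \<alpha>[OF w] act_mp[OF w] by (auto simp: V_def)
    show "\<alpha> (u + v) x = \<alpha> u (\<alpha> v x)" if uv: "u \<in> V" "v \<in> V" and x: "x \<in> space M" for u v x
    proof -
      obtain a b where ab: "u = \<psi> (w a)" "v = \<psi> (w b)" using uv by (auto simp: V_def)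
      have "\<alpha> (u + v) = act (w a \<otimes>\<^bsub>G\<^esub> w b)"
        unfolding ab \<psi>_mult[OF w w, symmetric] by (rule \<alpha>) (simp add: w)
      then show ?thesis using A.composition_rule[OF x w w] by (simp add: ab \<alpha>[OF w])
    qed
    show "weakly_mixing M (\<alpha> v)" if v: "v \<in> V" "v \<noteq> 0" for v
    proof -
      obtain a where a: "v = \<psi> (w a)" using v by (auto simp: V_def)
      then have "w a \<noteq> \<one>\<^bsub>G\<^esub>" using \<psi>.hom_one v(2) by auto
      then show ?thesis using assms(5) w by (simp add: a \<alpha>[OF w] totally_weak_mixing_def)
    qed
  qed
  define p where "p i n = \<psi> (poly_word G k T (P i) n)" for i n
  have pw: "poly_word G k T (P i) n = w (\<lambda>j. \<lfloor>poly (P i j) (of_int n)\<rfloor>)" for i n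
    by (simp add: poly_word_def w_def)
  have pwG: "poly_word G k T (P i) n \<in> carrier G" for i n unfolding pw by (rule w)
  define S where "S i N = power_word ?B k hatT (\<lambda>j. Q i j (int N))" for i N :: nat
  have S: "commuting (S i N)" for i N
    unfolding commuting_def
  proof (intro conjI ballI)
    show "measure_preserving_map M (S i N)"
      using hats by (simp add: S_def invertible_measure_preserving_def)
    show "S i N (\<alpha> v x) = \<alpha> v (S i N x)" if v: "v \<in> V" and x: "x \<in> space M" for v x
    proof -
      obtain a where "v = \<psi> (w a)" using v by (auto simp: V_def)
      then show ?thesis
        using mult_apply[OF x, of a "\<lambda>j. Q i j (int N)"] mult_apply'[OF x, of a "\<lambda>j. Q i j (int N)"]
        by (simp add: S_def \<alpha>[OF w])
    qed
  qed
  have f: "bdd (f i)" if "i \<in> {1..l}" for i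
    using assms(13)[OF that] by (auto simp: bounded_iff intro: bddI)
  have adm: "admissible {1..l} p"
    unfolding admissible_def
  proof (intro conjI ballI allI impI)
    fix i assume i: "i \<in> {1..l}"
    have "p i = (\<lambda>n. \<Sum>j = 1..k. frag_cmul \<lfloor>poly (P i j) (of_int n)\<rfloor> (\<psi> (T j)))"
      by (simp add: p_def pw \<psi>w fun_eq_iff)
    then show "\<exists>d. poly_deg_le d (p i)"
      using poly_deg_le_polynomial_word[of k "P i" "\<lambda>j. \<psi> (T j)"] assms(10)[OF i] by simp
    show "p i n \<in> V" for n by (simp add: p_def pw V_def)
    show "\<not> poly_deg_le 0 (p i)"
    proof
      assume "poly_deg_le 0 (p i)"
      then have "poly_word G k T (P i) n = poly_word G k T (P i) 0" for n
        unfolding poly_deg_le.simps p_def using inj pwG by (metis inj_onD)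
      then show False using assms(11)[OF i] unfolding constant_on_def by blast
    qed
  next
    fix i j assume i: "i \<in> {1..l}" and j: "j \<in> {1..l}" and "i \<noteq> j"
    let ?d = "\<lambda>n. poly_word G k T (P i) n \<otimes>\<^bsub>G\<^esub> inv\<^bsub>G\<^esub> (poly_word G k T (P j) n)"
    have eq: "p i n - p j n = \<psi> (?d n)" for n
      using \<psi>_mult[OF pwG AH.G.inv_closed[OF pwG]] \<psi>_inv[OF pwG] by (simp add: p_def)
    show "\<not> poly_deg_le 0 (\<lambda>n. p i n - p j n)"
    proof
      assume "poly_deg_le 0 (\<lambda>n. p i n - p j n)"
      then have "\<psi> (?d n) = \<psi> (?d 0)" for n unfolding poly_deg_le.simps eq by blast
      then have "?d n = ?d 0" for n
        by (rule inj_onD[OF inj]) (intro AH.G.m_closed AH.G.inv_closed pwG)+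
      then show False using assms(12)[OF i j \<open>i \<noteq> j\<close>] unfolding constant_on_def by blast
    qed
  qed simp
  define F where "F N x = (1 / of_nat N) * (\<Sum>n = 1..N. \<Prod>i = 1..l.
      f i ((act (poly_word G k T (P i) (int n)) \<otimes>\<^bsub>?B\<^esub>
        power_word ?B k hatT (\<lambda>j. Q i j (int N))) x))" for N x
  have F: "F N x = avg {1..l} p f S N x" if "x \<in> space M" for N x
    using that by (simp add: F_def avg_def orbit_prod_def p_def pw \<alpha>[OF w] mult_apply S_def)
  have "L2_null (\<lambda>N x. avg {1..l} p f S N x - (\<Prod>i = 1..l. \<integral>y. f i y \<partial>M))"
    using averages_converge_if_admissible[OF adm] f S unfolding averages_converge_def by blast
  moreover have "(\<integral>x. (cmod (F N x - (\<Prod>i = 1..l. \<integral>y. f i y \<partial>M)))\<^sup>2 \<partial>M)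
      = (\<integral>x. (cmod (avg {1..l} p f S N x - (\<Prod>i = 1..l. \<integral>y. f i y \<partial>M)))\<^sup>2 \<partial>M)" for N
    by (rule Bochner_Integration.integral_cong[OF refl]) (simp add: F)
  ultimately have lim: "(\<lambda>N. sqrt (\<integral>x. (cmod (F N x - (\<Prod>i = 1..l. \<integral>y. f i y \<partial>M)))\<^sup>2 \<partial>M)) \<longlonglongrightarrow> 0"
    unfolding L2_null_def using tendsto_real_sqrt by fastforce
  have sq: "square_integrable M g" if "bdd g" for g
    using bdd_measurable[OF that] bdd_integrable_norm_square[OF that] by (simp add: square_integrable_def)
  have bavg: "bdd (avg {1..l} p f S N)" for N
    by (rule bdd_avg) (use f S adm in \<open>auto simp: admissible_def\<close>)
  have "bdd (F N)" for N
    using bavg[of N] measurable_cong[of M "F N" "avg {1..l} p f S N" borel, OF F]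
    by (auto simp: bdd_def bdd_meas_def F)
  then have "tendsto_L2 M F (\<lambda>x. \<Prod>i = 1..l. \<integral>y. f i y \<partial>M)"
    unfolding tendsto_L2_def using lim sq bdd_const by blast
  then show ?thesis unfolding F_def .
qed

end
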